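(* For all generic values of $\tau,x_0,x_{\bar0},x_1,\dots,x_L\in\mathbb C$, the partition function satisfies \[ \mathcal M_0\,Z_\tau(X)+\sum_{i=1}^L\mathcal N_i\,Z_\tau(X_i^0)+\sum_{i=1}^L\bar{\mathcal N}_i\,Z_\tau(X_i^{\bar0})=0, \] with \[ \mathcal M_0=\prod_{j=1}^L\frac{[x_0-x_j+\gamma][x_0-\mu_j][x_{\bar0}-\mu_j+\gamma]}{[x_0-x_j][x_0-\mu_j+\gamma]}-\prod_{j=1}^L\frac{[x_{\bar0}-x_j+\gamma][x_{\bar0}-\mu_j]}{[x_{\bar0}-x_j]}, \] \[ \mathcal N_i=-\frac{[\gamma][x_0-x_i+\tau+(L+1)\gamma]}{[\tau+(L+1)\gamma][x_0-x_i]}\prod_{j=1}^L\frac{[x_i-\mu_j][x_{\bar0}-\mu_j+\gamma]}{[x_0-\mu_j+\gamma]}\prod_{\substack{j=1\\ j\ne i}}^L\frac{[x_i-x_j+\gamma]}{[x_i-x_j]}, \] \[ \bar{\mathcal N}_i=\frac{[\gamma][x_{\bar0}-x_i+\tau+(L+1)\gamma]}{[\tau+(L+1)\gamma][x_{\bar0}-x_i]}\prod_{j=1}^L[x_i-\mu_j]\prod_{\substack{j=1\\ j\ne i}}^L\frac{[x_i-x_j+\gamma]}{[x_i-x_j]}. \]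
   Context: Elliptic SOS setup. Fix $0<p<1$ and $\gamma\in\mathbb C$. For $x\in\mathbb C$ let $[x]:=\frac12\sum_{n\in\mathbb Z}(-1)^{n-\frac12}p^{(n+\frac12)^2}e^{-(2n+1)x}$ (the Jacobi theta function $\Theta_1(\mathrm i x,\nu)$, $p=e^{\mathrm i\pi\nu}$, in Whittaker–Watson conventions). Let $v_1,v_2$ be the standard basis of $\mathbb C^2$. The dynamical $R$-matrix $\mathcal R(x;\tau)\in\mathrm{End}(\mathbb C^2\otimes\mathbb C^2)$ is, in the ordered basis $v_1\otimes v_1, v_1\otimes v_2, v_2\otimes v_1, v_2\otimes v_2$, $\begin{pmatrix} a_+&0&0&0\\0&b_+&c_+&0\\0&c_-&b_-&0\\0&0&0&a_-\end{pmatrix}$ with $a_\pm=[x+\gamma]$, $b_\pm=[\tau\mp\gamma][x]/[\tau]$, $c_\pm=[\tau\mp x][\gamma]/[\tau]$. Fix $L\ge1$ and $\mu_1,\dots,\mu_L\in\mathbb C$. On $\mathbb C^2_0\otimes(\mathbb C^2)^{\otimes L}$ (auxiliary factor $0$, quantum factors $1,\dots,L$) let $h_k$ act on the $k$-th quantum factor by $h_kv_1=v_1$, $h_kv_2=-v_2$; $\mathcal R_{0i}(x;\tau-\gamma\sum_{k>i}h_k)$ denotes the operator acting on a tensor product of basis vectors whose $k$-th quantum factors have $h_k$-eigenvalues $\epsilon_k$ as $\mathcal R(x;\tau-\gamma\sum_{k>i}\epsilon_k)$ on factors $0,i$ and as identity elsewhere. The monodromy matrix is the ordered product $\mathcal T_0(x,\tau)=\mathcal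 R_{01}(x-\mu_1;\tau-\gamma\sum_{k=2}^Lh_k)\,\mathcal R_{02}(x-\mu_2;\tau-\gamma\sum_{k=3}^Lh_k)\cdots\mathcal R_{0L}(x-\mu_L;\tau)$, written as a $2\times2$ matrix in the auxiliary space (basis $v_1,v_2$) as $\begin{pmatrix}\mathcal A(x,\tau)&\mathcal B(x,\tau)\\ \mathcal C(x,\tau)&\mathcal D(x,\tau)\end{pmatrix}$ with entries in $\mathrm{End}((\mathbb C^2)^{\otimes L})$. Let $|0\rangle=v_1^{\otimes L}$ and $\langle\bar0|=(v_2^* )^{\otimes L}$ (dual basis covector). The partition function of the elliptic SOS model with domain-wall boundaries is $Z_\tau(x_1,\dots,x_L)=\langle\bar0|\mathcal B(x_1,\tau+\gamma)\mathcal B(x_2,\tau+2\gamma)\cdots\mathcal B(x_L,\tau+L\gamma)|0\rangle$. Notation: $X=(x_1,\dots,x_L)$; for an extra variable $x_\alpha$ and $1\le i\le L$, $X_i^\alpha$ is $X$ with $x_i$ replaced by $x_\alpha$. *)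

theory Defs
  imports "HOL-Analysis.Analysis"
begin

text \<open>Jacobi theta function [x] = (1/2) sum_{n in Z} (-1)^(n-1/2) p^((n+1/2)^2) e^(-(2n+1)x),
  with (-1)^(n-1/2) the principal value exp(i pi (n-1/2)).\<close>
definition theta :: "real \<Rightarrow> complex \<Rightarrow> complex" where
  "theta p x = (1/2) * (\<Sum>\<^sub>\<infinity> n::int.
      ((-1::complex) powr (of_int n - 1/2)) * complex_of_real (p powr ((real_of_int n + 1/2)^2))
      * exp (- (2 * of_int n + 1) * x))"

text \<open>Spins: True = v1 (h = +1), False = v2 (h = -1).\<close>
definition hval :: "bool \<Rightarrow> complex" where
  "hval b = (if b then 1 else -1)"

text \<open>Entry of the dynamical R-matrix R(x;tau) in row (a,b), column (a',b').\<close>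
definition Rmat :: "real \<Rightarrow> complex \<Rightarrow> complex \<Rightarrow> complex \<Rightarrow> bool \<Rightarrow> bool \<Rightarrow> bool \<Rightarrow> bool \<Rightarrow> complex" where
  "Rmat p g x tau a b a' b' =
    (if a = b then (if a' = a \<and> b' = b then theta p (x + g) else 0)
     else if a' = a \<and> b' = b then
        (if a then theta p (tau - g) * theta p x / theta p tau
              else theta p (tau + g) * theta p x / theta p tau)
     else if a' = b \<and> b' = a then
        (if a then theta p (tau - x) * theta p g / theta p tau
              else theta p (tau + x) * theta p g / theta p tau)
     else 0)"

text \<open>Matrix element of the ordered product R_{0i} R_{0(i+1)} ... over the quantum
  factors i, i+1, ... (states given as lists): auxiliary out a, auxiliary in c,
  quantum out-state, quantum in-state.  The dynamical shift of R_{0i} uses the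
  h-eigenvalues of the factors k > i at the moment R_{0i} acts.\<close>
fun monoT :: "real \<Rightarrow> complex \<Rightarrow> (nat \<Rightarrow> complex) \<Rightarrow> nat \<Rightarrow> complex \<Rightarrow> complex
               \<Rightarrow> bool \<Rightarrow> bool \<Rightarrow> bool list \<Rightarrow> bool list \<Rightarrow> complex" where
  "monoT p g mu i x tau a c [] [] = (if a = c then 1 else 0)"
| "monoT p g mu i x tau a c (e' # es') (e # es) =
     (\<Sum>b\<in>UNIV. Rmat p g (x - mu i) (tau - g * sum_list (map hval es')) a e' b e
                 * monoT p g mu (Suc i) x tau b c es' es)"
| "monoT p g mu i x tau a c _ _ = 0"

definition Bop :: "real \<Rightarrow> complex \<Rightarrow> (nat \<Rightarrow> complex) \<Rightarrow> complex \<Rightarrow> complex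
                   \<Rightarrow> bool list \<Rightarrow> bool list \<Rightarrow> complex" where
  "Bop p g mu x tau out inp = monoT p g mu 1 x tau True False out inp"

fun chainB :: "real \<Rightarrow> complex \<Rightarrow> (nat \<Rightarrow> complex) \<Rightarrow> nat \<Rightarrow> complex \<Rightarrow> nat
               \<Rightarrow> complex list \<Rightarrow> bool list \<Rightarrow> complex" where
  "chainB p g mu L tau k [] s = (if s = replicate L True then 1 else 0)"
| "chainB p g mu L tau k (x # xs) s =
     (\<Sum>t\<in>{t::bool list. length t = L}.
        Bop p g mu x (tau + of_nat k * g) s t * chainB p g mu L tau (Suc k) xs t)"

definition Zpf :: "real \<Rightarrow> complex \<Rightarrow> (nat \<Rightarrow> complex) \<Rightarrow> nat \<Rightarrow> complex \<Rightarrow> (nat \<Rightarrow> complex) \<Rightarrow> complex" where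
  "Zpf p g mu L tau X = chainB p g mu L tau 1 (map X [1..<L+1]) (replicate L False)"

end

theory Submission
  imports Defs "HOL-Complex_Analysis.Conformal_Mappings"
begin

text \<open>Write \<open>[x]\<close> for \<open>theta p x\<close>. By the dynamical Yang-Baxter relations, the operator \<open>D(y, tau + g)\<close>
  can be moved through \<open>B(x\<^sub>1, tau + 2 g) \<dots> B(x\<^sub>L, tau + (L+1) g)\<close> to the right; each exchange lowers the
  dynamical parameter of a \<open>B\<close> by \<open>g\<close>. Both the state of all spins down on the left and the state of
  all spins up on the right are eigenvectors of \<open>D\<close>, so the matrix element is evaluated in two ways:
  as \<open>\<Prod>\<^sub>j [y - \<mu>\<^sub>j + g]\<close> times a partition function at shifted dynamical parameter, which does not
  involve \<open>y\<close>, and as a combination of \<open>Z\<^sub>\<tau>(X)\<close> and the \<open>Z\<^sub>\<tau>\<close> with \<open>x\<^sub>i\<close> replaced by \<open>y\<close>. Eliminating the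
  shifted partition function between \<open>y = x\<^sub>0\<close> and \<open>y = x\<^sub>b\<close> yields the claim.\<close>

section \<open>The theta function\<close>

text \<open>Two obstacles shape the proof. First, the R-matrix that governs the exchange of D and B
  carries a dynamical parameter depending on the state it meets. Weight conservation replaces that
  state by the number of B's still to pass, so all exchange coefficients become plain theta
  quotients. Second, each exchange also creates an unwanted term in which D takes over the argument
  of the B. Passing all B's would give exponentially many terms; an induction on the list of
  arguments merges, at every step, the two contributions in which the same argument has been lost.
  The merging needs only the symmetry of products of B and one theta identity.

  Apart from oddness, every theta identity here, in the Yang-Baxter equation as in the merging, is
  an instance of the three-term relation. The bound \<open>2 * int L + 2\<close> on the excluded
  zeros adds the largest multiple \<open>L + 2\<close> of \<open>g\<close> in a monodromy matrix to
  the largest weight \<open>L\<close> of a state.\<close>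

lemma exp_neg_abs_summable_on_int:
  "(\<lambda>n::int. exp (- \<bar>real_of_int n\<bar>)) summable_on UNIV"
proof -
  have nat: "(\<lambda>n::nat. exp (- real n)) summable_on UNIV"
  proof (rule norm_summable_imp_summable_on)
    have "summable (\<lambda>n::nat. exp (-1 :: real) ^ n)"
      by (rule summable_geometric) simp
    then show "summable (\<lambda>n::nat. norm (exp (- real n)))"
      by (simp add: exp_of_nat_mult [symmetric])
  qed
  have "(\<lambda>n::int. exp (- \<bar>real_of_int n\<bar>)) summable_on range int"
    by (subst summable_on_reindex) (use nat in \<open>auto simp: o_def\<close>)
  moreover have "(\<lambda>n::int. exp (- \<bar>real_of_int n\<bar>)) summable_on range (\<lambda>n. - int n)"
    by (subst summable_on_reindex) (use nat in \<open>auto simp: o_def inj_on_def\<close>)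
  ultimately have "(\<lambda>n::int. exp (- \<bar>real_of_int n\<bar>)) summable_on (range int \<union> range (\<lambda>n. - int n))"
    by (rule summable_on_union)
  moreover have "range int \<union> range (\<lambda>n. - int n) = UNIV"
    by (metis (mono_tags, lifting) UNIV_eq_I Un_iff int_cases2 rangeI)
  ultimately show ?thesis by simp
qed

text \<open>The linear term absorbs the exponential factor of the theta series uniformly for
  arguments in a disc, so this one majorant gives both absolute convergence and the M-test.\<close>

lemma gauss_exp_summable_on_int:
  fixes a s R :: real
  assumes "a > 0"
  shows "(\<lambda>n::int. exp (- a * (of_int n + s)^2 + R * \<bar>of_int n + s\<bar>)) summable_on UNIV"
proof (rule summable_on_comparison_test)
  \<comment> \<open>\<open>(R + 1)^2 / (4 * a)\<close> is the maximum of
    \<open>(R + 1) * m - a * m^2\<close>; the spare \<open>- m\<close> then supplies the decay in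
    \<open>n\<close>, up to the offset \<open>s\<close>.\<close>
  define C where "C = exp ((R + 1)^2 / (4 * a) + \<bar>s\<bar>)"
  show "(\<lambda>n::int. C * exp (- \<bar>real_of_int n\<bar>)) summable_on UNIV"
    by (intro summable_on_cmult_right exp_neg_abs_summable_on_int)
  show "exp (- a * (of_int n + s)^2 + R * \<bar>of_int n + s\<bar>) \<le> C * exp (- \<bar>real_of_int n\<bar>)" for n
  proof -
    define m where "m = \<bar>of_int n + s\<bar>"
    have "0 \<le> (2 * a * m - (R + 1))\<^sup>2 / (4 * a)" using assms by simp
    also have "\<dots> = a * m\<^sup>2 - (R + 1) * m + (R + 1)\<^sup>2 / (4 * a)"
      using assms by (simp add: field_simps power2_eq_square)
    finally have "- a * m\<^sup>2 + R * m \<le> (R + 1)\<^sup>2 / (4 * a) - m"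
      by (simp add: algebra_simps)
    moreover have "\<bar>real_of_int n\<bar> - \<bar>s\<bar> \<le> m" unfolding m_def by linarith
    ultimately have "- a * m\<^sup>2 + R * m \<le> (R + 1)\<^sup>2 / (4 * a) + \<bar>s\<bar> + - \<bar>real_of_int n\<bar>"
      by linarith
    then show ?thesis
      unfolding C_def exp_add [symmetric] by (simp add: m_def)
  qed
qed auto

definition theta_term :: "real \<Rightarrow> complex \<Rightarrow> int \<Rightarrow> complex" where
  "theta_term p x n = ((-1::complex) powr (of_int n - 1/2)) * complex_of_real (p powr ((real_of_int n + 1/2)^2))
      * exp (- (2 * of_int n + 1) * x)"

lemma theta_eq_infsum: "theta p x = (1/2) * (\<Sum>\<^sub>\<infinity>n. theta_term p x n)"
  by (simp add: theta_def theta_term_def)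

lemma neg_one_powr_eq: "(-1::complex) powr (of_int n - 1/2) = (if even n then - \<i> else \<i>)"
proof -
  have "(-1::complex) powr (of_int n - 1/2) = (-1) powr of_int n * (-1) powr (- (1/2))"
    by (simp add: powr_add [symmetric])
  also have "(-1::complex) powr (- (1/2)) = cis (- (pi / 2))"
    by (simp add: powr_def cis_conv_exp)
  also have "\<dots> = - \<i>"
    by (simp add: complex_eq_iff)
  also have "(-1::complex) powr of_int n = (if even n then 1 else -1)"
    by (auto simp: powr_of_int power_int_def minus_one_power_iff even_nat_iff)
  finally show ?thesis by simp
qed

lemma norm_theta_term_le:
  assumes "0 < p" "norm x \<le> R"
  shows "norm (theta_term p x n) \<le> exp (- (- ln p) * (of_int n + 1/2)^2 + 2 * R * \<bar>of_int n + 1/2\<bar>)"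
proof -
  have "Re (- (2 * of_int n + 1) * x) \<le> norm (- (2 * of_int n + 1) * x)"
    by (rule complex_Re_le_cmod)
  also have "\<dots> = \<bar>2 * of_int n + 1\<bar> * norm x"
  proof -
    have "norm (- (2 * of_int n + 1) :: complex) = norm (of_real (- (2 * of_int n + 1)) :: complex)"
      by (simp only: of_real_minus of_real_add of_real_mult of_real_of_int_eq of_real_numeral of_real_1)
    also have "\<dots> = \<bar>2 * of_int n + 1\<bar>"
      by (simp only: norm_of_real abs_minus)
    finally show ?thesis by (simp add: norm_mult)
  qed
  also have "\<dots> \<le> \<bar>2 * of_int n + 1\<bar> * R"
    by (rule mult_left_mono) (use assms in auto)
  also have "\<dots> = 2 * R * \<bar>of_int n + 1/2\<bar>"
    by (simp add: abs_if algebra_simps)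
  finally have *: "exp (Re (- (2 * of_int n + 1) * x)) \<le> exp (2 * R * \<bar>of_int n + 1/2\<bar>)"
    by simp
  have sgn: "norm ((-1::complex) powr (of_int n - 1/2)) = 1"
    by (simp add: neg_one_powr_eq)
  have "norm (theta_term p x n) = exp (ln p * (of_int n + 1/2)^2) * exp (Re (- (2 * of_int n + 1) * x))"
    unfolding theta_term_def norm_mult sgn norm_of_real norm_exp_eq_Re
    using assms by (simp add: powr_def mult.commute)
  also have "\<dots> \<le> exp (ln p * (of_int n + 1/2)^2) * exp (2 * R * \<bar>of_int n + 1/2\<bar>)"
    using * by (rule mult_left_mono) simp
  finally show ?thesis by (simp add: exp_add [symmetric])
qed

lemma theta_term_abs_summable:
  assumes "0 < p" "p < 1"
  shows "(\<lambda>n. norm (theta_term p x n)) summable_on UNIV"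
proof (rule Infinite_Sum.abs_summable_on_comparison_test')
  show "(\<lambda>n::int. exp (- (- ln p) * (of_int n + 1/2)^2 + 2 * norm x * \<bar>of_int n + 1/2\<bar>)) summable_on UNIV"
    using assms by (intro gauss_exp_summable_on_int) auto
qed (use assms in \<open>intro norm_theta_term_le, auto\<close>)

lemma holomorphic_theta:
  assumes "0 < p" "p < 1"
  shows "theta p holomorphic_on UNIV"
proof -
  have "(\<lambda>x. \<Sum>\<^sub>\<infinity>n. theta_term p x n) holomorphic_on ball 0 R" for R
  proof (rule holomorphic_uniform_limit)
    show "uniform_limit (cball 0 R) (\<lambda>A x. \<Sum>n\<in>A. theta_term p x n)
            (\<lambda>x. \<Sum>\<^sub>\<infinity>n. theta_term p x n) (finite_subsets_at_top UNIV)"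
    proof (rule Weierstrass_m_test_general)
      show "norm (theta_term p x n) \<le> exp (- (- ln p) * (of_int n + 1/2)^2 + 2 * R * \<bar>of_int n + 1/2\<bar>)"
        if "x \<in> cball 0 R" for n x
        using that assms by (intro norm_theta_term_le) auto
      show "(\<lambda>n::int. exp (- (- ln p) * (of_int n + 1/2)^2 + 2 * R * \<bar>of_int n + 1/2\<bar>)) summable_on UNIV"
        using assms by (intro gauss_exp_summable_on_int) auto
    qed
    show "\<forall>\<^sub>F A in finite_subsets_at_top UNIV. continuous_on (cball 0 R) (\<lambda>x. \<Sum>n\<in>A. theta_term p x n)
            \<and> (\<lambda>x. \<Sum>n\<in>A. theta_term p x n) holomorphic_on ball 0 R"
      unfolding theta_term_def
      by (intro always_eventually allI conjI continuous_intros holomorphic_intros)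
  qed auto
  then have hol: "theta p holomorphic_on ball 0 R" for R
    unfolding theta_eq_infsum by (intro holomorphic_intros)
  have "theta p field_differentiable at x" for x
    using hol [of "norm x + 1"] by (rule holomorphic_on_imp_differentiable_at) auto
  then show ?thesis
    by (simp add: holomorphic_on_def)
qed

lemma continuous_on_theta [continuous_intros]:
  assumes "0 < p" "p < 1" "continuous_on S f"
  shows "continuous_on S (\<lambda>x. theta p (f x))"
  using continuous_on_compose2 [OF holomorphic_on_imp_continuous_on [OF holomorphic_theta]] assms
  by blast

text \<open>The reflection of \<open>n\<close> to \<open>- n - 1\<close> keeps
  \<open>(n + 1/2)^2\<close>, negates \<open>2 n + 1\<close> and changes the parity of
  \<open>n\<close>, hence the sign.\<close>

lemma theta_minus: "theta p (- x) = - theta p x"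
proof -
  have "(\<Sum>\<^sub>\<infinity>n. theta_term p (- x) n) = (\<Sum>\<^sub>\<infinity>n. - theta_term p x n)"
  proof (rule infsum_reindex_bij_witness [of _ "\<lambda>n. - n - 1" "\<lambda>n. - n - 1"])
    fix n :: int
    have "(real_of_int (- n - 1) + 1 / 2)\<^sup>2 = (real_of_int n + 1/2)\<^sup>2"
      by (simp add: power2_eq_square algebra_simps)
    moreover have "- (2 * complex_of_int (- n - 1) + 1) * x = - (2 * of_int n + 1) * (- x)"
      by (simp add: algebra_simps)
    ultimately show "- theta_term p x (- n - 1) = theta_term p (- x) n"
      unfolding theta_term_def neg_one_powr_eq by simp
  qed auto
  then show ?thesis
    by (simp add: theta_eq_infsum infsum_uminus)
qed

section \<open>Products of two theta functions and the three-term relation\<close>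

lemma infsum_mult_infsum:
  fixes f :: "'a \<Rightarrow> 'c :: {real_normed_div_algebra, banach}"
  assumes f: "(\<lambda>x. norm (f x)) summable_on A" and g: "(\<lambda>x. norm (g x)) summable_on B"
  shows "infsum f A * infsum g B = (\<Sum>\<^sub>\<infinity>(x,y)\<in>A \<times> B. f x * g y)"
    and "(\<lambda>(x,y). f x * g y) summable_on A \<times> B"
proof -
  have "(\<lambda>xy. norm (case xy of (x, y) \<Rightarrow> f x * g y)) summable_on A \<times> B"
    unfolding Infinite_Sum.abs_summable_on_Sigma_iff
    using f g by (auto simp: norm_mult infsum_cmult_right' abs_mult
        intro!: summable_on_cmult_right summable_on_cmult_left)
  then show *: "(\<lambda>(x,y). f x * g y) summable_on A \<times> B"
    by (rule abs_summable_summable)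
  show "infsum f A * infsum g B = (\<Sum>\<^sub>\<infinity>(x,y)\<in>A \<times> B. f x * g y)"
    using infsum_Sigma'_banach [OF *] by (simp add: infsum_cmult_right' infsum_cmult_left')
qed

text \<open>In the double series of \<open>[x + z] [x - z]\<close> over \<open>(m, n)\<close>, the indices \<open>a = m + n + 1\<close> and
  \<open>b = m - n\<close> run over all pairs of opposite parity and separate \<open>x\<close> from \<open>z\<close>. Hence
  \<open>[x + z] [x - z]\<close> is an antisymmetric form of rank 2, and the three-term relation is the
  Plucker relation for it.\<close>

definition double_term :: "real \<Rightarrow> complex \<Rightarrow> int \<Rightarrow> complex" where
  "double_term p x a = complex_of_real (p powr (of_int a ^ 2 / 2)) * exp (- 2 * of_int a * x)"

lemma double_term_abs_summable:
  assumes "0 < p" "p < 1"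
  shows "(\<lambda>a. norm (double_term p x a)) summable_on A"
proof -
  have "(\<lambda>a::int. exp (- (- ln p / 2) * (of_int a + 0)^2 + 2 * norm x * \<bar>of_int a + 0\<bar>)) summable_on UNIV"
    using assms by (intro gauss_exp_summable_on_int) auto
  then have "(\<lambda>a. norm (double_term p x a)) summable_on UNIV"
  proof (rule Infinite_Sum.abs_summable_on_comparison_test')
    fix a :: int
    have "Re (- 2 * of_int a * x) \<le> norm (- 2 * of_int a * x)"
      by (rule complex_Re_le_cmod)
    also have "\<dots> = 2 * norm x * \<bar>of_int a\<bar>"
      by (simp add: norm_mult)
    finally have *: "exp (Re (- 2 * of_int a * x)) \<le> exp (2 * norm x * \<bar>of_int a\<bar>)"
      by simp
    have "norm (double_term p x a) = exp (ln p / 2 * (of_int a)^2) * exp (Re (- 2 * of_int a * x))"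
      unfolding double_term_def norm_mult norm_of_real norm_exp_eq_Re
      using assms by (simp add: powr_def mult.commute)
    also have "\<dots> \<le> exp (ln p / 2 * (of_int a)^2) * exp (2 * norm x * \<bar>of_int a\<bar>)"
      using * by (rule mult_left_mono) simp
    finally show "norm (double_term p x a)
        \<le> exp (- (- ln p / 2) * (of_int a + 0)^2 + 2 * norm x * \<bar>of_int a + 0\<bar>)"
      by (simp add: exp_add [symmetric])
  qed
  then show ?thesis
    by (rule summable_on_subset) auto
qed

text \<open>The exponents separate because \<open>(m + 1/2)^2 + (n + 1/2)^2\<close> is half of
  \<open>(m + n + 1)^2 + (m - n)^2\<close>. The sign is a product of two factors \<open>\<i>\<close>
  or \<open>- \<i>\<close>, which are equal exactly when \<open>m\<close> and \<open>n\<close> have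
  the same parity.\<close>

lemma theta_term_mult:
  assumes "0 < p"
  shows "theta_term p (x + z) m * theta_term p (x - z) n
       = (if even (m + n) then -1 else 1) * (double_term p x (m + n + 1) * double_term p z (m - n))"
proof -
  have "p powr ((real_of_int m + 1/2)^2) * p powr ((real_of_int n + 1/2)^2)
      = p powr (of_int (m + n + 1) ^ 2 / 2) * p powr (of_int (m - n) ^ 2 / 2)"
    unfolding powr_add [symmetric] by (rule arg_cong [of _ _ "(powr) p"])
      (simp add: power2_eq_square field_simps)
  then have 1: "complex_of_real (p powr ((real_of_int m + 1/2)^2)) * complex_of_real (p powr ((real_of_int n + 1/2)^2))
      = complex_of_real (p powr (of_int (m + n + 1) ^ 2 / 2)) * complex_of_real (p powr (of_int (m - n) ^ 2 / 2))"
    by (simp only: of_real_mult [symmetric])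
  have 2: "exp (- (2 * of_int m + 1) * (x + z)) * exp (- (2 * of_int n + 1) * (x - z))
     = exp (- 2 * of_int (m + n + 1) * x) * exp (- 2 * of_int (m - n) * z)"
    unfolding exp_add [symmetric] by (rule arg_cong [of _ _ exp]) (simp add: algebra_simps)
  have 3: "(-1::complex) powr (of_int m - 1/2) * (-1::complex) powr (of_int n - 1/2)
     = (if even (m + n) then -1 else 1)"
    unfolding neg_one_powr_eq by auto
  have *: "a * b * c * (a' * b' * c') = (a * a') * ((b * b') * (c * c'))" for a b c a' b' c' :: complex
    by simp
  show ?thesis
    unfolding theta_term_def double_term_def * 1 2 3 by simp
qed

definition double_even :: "real \<Rightarrow> complex \<Rightarrow> complex" where
  "double_even p x = (\<Sum>\<^sub>\<infinity>a\<in>{a. even a}. double_term p x a)"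

definition double_odd :: "real \<Rightarrow> complex \<Rightarrow> complex" where
  "double_odd p x = (\<Sum>\<^sub>\<infinity>a\<in>{a. odd a}. double_term p x a)"

lemma theta_mult_theta:
  assumes p: "0 < p" "p < 1"
  shows "theta p (x + z) * theta p (x - z)
       = (double_even p x * double_odd p z - double_odd p x * double_even p z) / 4"
proof -
  define F :: "int \<times> int \<Rightarrow> complex" where "F = (\<lambda>(a,b). double_term p x a * double_term p z b)"
  \<comment> \<open>The sign in the new indices: \<open>b = m - n\<close> is even exactly when
    \<open>m + n\<close> is.\<close>
  define s :: "int \<times> int \<Rightarrow> complex" where "s = (\<lambda>(a,b). if even b then -1 else 1)"
  let ?E = "{a::int. even a}" and ?O = "{a::int. odd a}"
  have prod: "infsum (double_term p x) A * infsum (double_term p z) B = infsum F (A \<times> B)"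
    "F summable_on A \<times> B" for A B
    unfolding F_def by (intro infsum_mult_infsum double_term_abs_summable p)+
  have "(\<Sum>\<^sub>\<infinity>n. theta_term p (x + z) n) * (\<Sum>\<^sub>\<infinity>n. theta_term p (x - z) n)
      = (\<Sum>\<^sub>\<infinity>(m,n)\<in>UNIV \<times> UNIV. theta_term p (x + z) m * theta_term p (x - z) n)"
    by (intro infsum_mult_infsum theta_term_abs_summable p)
  also have "\<dots> = (\<Sum>\<^sub>\<infinity>ab\<in>?E \<times> ?O \<union> ?O \<times> ?E. s ab * F ab)"
  \<comment> \<open>Opposite parity of \<open>a\<close> and \<open>b\<close> makes both divisions by
    2 exact.\<close>
  proof (rule infsum_reindex_bij_witness [of _ "\<lambda>(a,b). ((a + b - 1) div 2, (a - b - 1) div 2)"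
        "\<lambda>(m,n). (m + n + 1, m - n)"])
    fix mn :: "int \<times> int"
    show "s (case mn of (m, n) \<Rightarrow> (m + n + 1, m - n)) * F (case mn of (m, n) \<Rightarrow> (m + n + 1, m - n))
        = (case mn of (m, n) \<Rightarrow> theta_term p (x + z) m * theta_term p (x - z) n)"
      by (cases mn) (simp add: theta_term_mult p s_def F_def)
  next
    fix ab :: "int \<times> int"
    assume ab: "ab \<in> ?E \<times> ?O \<union> ?O \<times> ?E"
    obtain a b where [simp]: "ab = (a, b)" by (cases ab)
    have "odd (a + b)" using ab by auto
    then obtain k where k: "a + b = 2 * k + 1" by (rule oddE)
    then have b: "b = 2 * k + 1 - a" by simp
    show "(case case ab of (a, b) \<Rightarrow> ((a + b - 1) div 2, (a - b - 1) div 2) of (m, n) \<Rightarrow> (m + n + 1, m - n)) = ab"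
      by (simp add: b)
  qed auto
  also have "\<dots> = (\<Sum>\<^sub>\<infinity>ab\<in>?E \<times> ?O. s ab * F ab) + (\<Sum>\<^sub>\<infinity>ab\<in>?O \<times> ?E. s ab * F ab)"
  proof (rule infsum_Un_disjoint)
    show "(\<lambda>ab. s ab * F ab) summable_on ?E \<times> ?O"
      using prod(2) [of ?E ?O] by (rule summable_on_cong [THEN iffD1, rotated]) (auto simp: s_def)
    have "(\<lambda>ab. - F ab) summable_on ?O \<times> ?E"
      using prod(2) [of ?O ?E] by (simp add: summable_on_uminus)
    then show "(\<lambda>ab. s ab * F ab) summable_on ?O \<times> ?E"
      by (rule summable_on_cong [THEN iffD1, rotated]) (auto simp: s_def)
  qed auto
  also have "(\<Sum>\<^sub>\<infinity>ab\<in>?E \<times> ?O. s ab * F ab) = (\<Sum>\<^sub>\<infinity>ab\<in>?E \<times> ?O. F ab)"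
    by (rule infsum_cong) (auto simp: s_def)
  also have "(\<Sum>\<^sub>\<infinity>ab\<in>?O \<times> ?E. s ab * F ab) = (\<Sum>\<^sub>\<infinity>ab\<in>?O \<times> ?E. - F ab)"
    by (rule infsum_cong) (auto simp: s_def)
  also have "\<dots> = - (\<Sum>\<^sub>\<infinity>ab\<in>?O \<times> ?E. F ab)"
    by (rule infsum_uminus)
  finally show ?thesis
    by (simp add: theta_eq_infsum prod(1) [symmetric] double_even_def double_odd_def)
qed

text \<open>The substitution avoids the half-integral arguments of the symmetric form.\<close>

lemma theta_three_term:
  assumes "0 < p" "p < 1"
  shows "theta p \<beta> * theta p \<alpha> * theta p (\<delta> + \<beta> - \<epsilon>) * theta p (\<delta> - \<alpha> + \<epsilon>)
       - theta p (\<alpha> + \<beta> - \<epsilon>) * theta p \<epsilon> * theta p (\<delta> + \<beta> - \<alpha>) * theta p \<delta>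
       = theta p (\<delta> + \<beta>) * theta p (\<alpha> - \<delta>) * theta p (\<beta> - \<epsilon>) * theta p (\<epsilon> - \<alpha>)"
proof -
  define x z where "x = (\<beta> + \<alpha>) / 2" and "z = (\<beta> - \<alpha>) / 2"
  define y w where "y = \<delta> + z" and "w = x - \<epsilon>"
  have args: "\<beta> = x + z" "\<alpha> = x - z" "\<delta> + \<beta> - \<epsilon> = y + w" "\<delta> - \<alpha> + \<epsilon> = y - w"
    "\<alpha> + \<beta> - \<epsilon> = x + w" "\<epsilon> = x - w" "\<delta> + \<beta> - \<alpha> = y + z" "\<delta> = y - z"
    "\<delta> + \<beta> = x + y" "\<alpha> - \<delta> = x - y" "\<beta> - \<epsilon> = z + w" "\<epsilon> - \<alpha> = z - w"
    by (simp_all add: x_def y_def z_def w_def field_simps)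
  note m = theta_mult_theta [OF assms]
  have "(theta p (x + z) * theta p (x - z)) * (theta p (y + w) * theta p (y - w))
      - (theta p (x + w) * theta p (x - w)) * (theta p (y + z) * theta p (y - z))
      = (theta p (x + y) * theta p (x - y)) * (theta p (z + w) * theta p (z - w))"
    unfolding m by (simp add: field_simps)
  then show ?thesis
    by (simp only: args [symmetric] mult.assoc)
qed

text \<open>Identity theorem: a zero set with interior would force \<open>theta p\<close> to vanish
  everywhere, against the witness \<open>c\<close>. The density serves to cancel theta factors by
  continuity.\<close>

lemma closure_theta_nonzero:
  assumes "0 < p" "p < 1" "theta p c \<noteq> 0"
  shows "closure {x. theta p x \<noteq> 0} = UNIV"
proof (rule ccontr)
  assume "closure {x. theta p x \<noteq> 0} \<noteq> UNIV"
  then have "interior {x. theta p x = 0} \<noteq> {}"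
    by (auto simp: closure_interior Compl_eq)
  then have "theta p c = 0"
    using analytic_continuation_open [of "interior {x. theta p x = 0}" UNIV "theta p" "\<lambda>_. 0" c]
      holomorphic_theta [OF assms(1,2)] interior_subset by auto
  with assms show False by simp
qed

section \<open>The dynamical Yang-Baxter equation\<close>

lemma Rmat_simps:
  "Rmat p g x t a a a a = theta p (x + g)"
  "Rmat p g x t True False True False = theta p (t - g) * theta p x / theta p t"
  "Rmat p g x t False True False True = theta p (t + g) * theta p x / theta p t"
  "Rmat p g x t True False False True = theta p (t - x) * theta p g / theta p t"
  "Rmat p g x t False True True False = theta p (t + x) * theta p g / theta p t"
  by (simp_all add: Rmat_def)

lemma Rmat_eq_0:
  "a \<noteq> b \<Longrightarrow> Rmat p g x t a a b c = 0" "a \<noteq> b \<Longrightarrow> Rmat p g x t a a c b = 0"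
  "a \<noteq> b \<Longrightarrow> Rmat p g x t a b c c = 0"
  by (auto simp: Rmat_def)

text \<open>Oddness of theta: negating the dynamical parameter changes the sign of numerator and
  denominator alike, and thereby interchanges the entries with index + and those with index
  -.\<close>

lemma Rmat_flip: "Rmat p g x (- t) (\<not> a) (\<not> b) (\<not> c) (\<not> d) = Rmat p g x t a b c d"
  using theta_minus [of p "t + g"] theta_minus [of p "t - g"]
    theta_minus [of p "t + x"] theta_minus [of p "t - x"]
  by (cases a; cases b; cases c; cases d) (simp_all add: Rmat_simps Rmat_eq_0 theta_minus)

lemma hval_not [simp]: "hval (\<not> b) = - hval b"
  by (simp add: hval_def)

text \<open>Matrix element of R12(u; r - g h3) R13(u+v; r) R23(v; r - g h1), where \<open>a3\<close>
  and \<open>c1\<close> are the spins that h3 and h1 see. The other side below is R23(v; r) R13(u+v;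
  r - g h2) R12(u; r), with h2 read off the intermediate spin \<open>b2\<close>.\<close>

definition dybe_lhs :: "real \<Rightarrow> complex \<Rightarrow> complex \<Rightarrow> complex \<Rightarrow> complex \<Rightarrow>
    bool \<Rightarrow> bool \<Rightarrow> bool \<Rightarrow> bool \<Rightarrow> bool \<Rightarrow> bool \<Rightarrow> complex" where
  "dybe_lhs p g u v r a1 a2 a3 c1 c2 c3 =
    (\<Sum>b1\<in>UNIV. \<Sum>b2\<in>UNIV. \<Sum>b3\<in>UNIV. Rmat p g u (r - g * hval a3) a1 a2 b1 b2
       * Rmat p g (u + v) r b1 a3 c1 b3 * Rmat p g v (r - g * hval c1) b2 b3 c2 c3)"

definition dybe_rhs :: "real \<Rightarrow> complex \<Rightarrow> complex \<Rightarrow> complex \<Rightarrow> complex \<Rightarrow>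
    bool \<Rightarrow> bool \<Rightarrow> bool \<Rightarrow> bool \<Rightarrow> bool \<Rightarrow> bool \<Rightarrow> complex" where
  "dybe_rhs p g u v r a1 a2 a3 c1 c2 c3 =
    (\<Sum>b1\<in>UNIV. \<Sum>b2\<in>UNIV. \<Sum>b3\<in>UNIV. Rmat p g v r a2 a3 b2 b3
       * Rmat p g (u + v) (r - g * hval b2) a1 b3 b1 c3 * Rmat p g u r b1 b2 c1 c2)"

text \<open>Flipping all spins amounts to \<open>r \<mapsto> - r\<close>, so the states with at least two spins up suffice.\<close>

lemma dybe_flip:
  "dybe_lhs p g u v (- r) (\<not> a1) (\<not> a2) (\<not> a3) (\<not> c1) (\<not> c2) (\<not> c3) = dybe_lhs p g u v r a1 a2 a3 c1 c2 c3"
  "dybe_rhs p g u v (- r) (\<not> a1) (\<not> a2) (\<not> a3) (\<not> c1) (\<not> c2) (\<not> c3) = dybe_rhs p g u v r a1 a2 a3 c1 c2 c3"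
proof -
  have sum_not: "(\<Sum>b\<in>UNIV. f (\<not> b)) = (\<Sum>b\<in>UNIV. f b)" for f :: "bool \<Rightarrow> complex"
    by (simp add: UNIV_bool add.commute)
  have flip: "Rmat p g x (- r - g * - h) (\<not> a) (\<not> b) (\<not> c) (\<not> d) = Rmat p g x (r - g * h) a b c d" for x h a b c d
    using Rmat_flip [of p g x "r - g * h"] by simp
  show "dybe_lhs p g u v (- r) (\<not> a1) (\<not> a2) (\<not> a3) (\<not> c1) (\<not> c2) (\<not> c3) = dybe_lhs p g u v r a1 a2 a3 c1 c2 c3"
    unfolding dybe_lhs_def
    by (subst (1 2 3) sum_not [symmetric]) (simp only: hval_not flip Rmat_flip)
  show "dybe_rhs p g u v (- r) (\<not> a1) (\<not> a2) (\<not> a3) (\<not> c1) (\<not> c2) (\<not> c3) = dybe_rhs p g u v r a1 a2 a3 c1 c2 c3"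
    unfolding dybe_rhs_def
    by (subst (1 2 3) sum_not [symmetric]) (simp only: hval_not flip Rmat_flip)
qed

text \<open>Both sides conserve the number of spins up, so beyond the all-up entry only a block of
  nine entries remains. Two of these agree factor by factor; clearing denominators in the other
  seven leaves theta identities that specialise the three-term relation.\<close>

lemma dybe_two_up:
  assumes p: "0 < p" "p < 1"
    and nz: "theta p r \<noteq> 0" "theta p (r - g) \<noteq> 0" "theta p (r + g) \<noteq> 0"
    and up: "a1 \<and> a2 \<or> a1 \<and> a3 \<or> a2 \<and> a3"
  shows "dybe_lhs p g u v r a1 a2 a3 c1 c2 c3 = dybe_rhs p g u v r a1 a2 a3 c1 c2 c3"
proof -
  have t1: "theta p (u + g) * theta p (u + v) * theta p r * theta p (r - v - g) - theta p u * theta p (u + v + g) * theta p (r - g) * theta p (r - v)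
      = theta p (r - u - v - g) * theta p (r + u) * theta p v * theta p g"
    using theta_three_term [OF p, of "u + g" "u + v" "- (r - v)" "u + v + g"]
      theta_minus [of p "r"] theta_minus [of p "r - v - g"] theta_minus [of p "r - g"] theta_minus [of p "r - v"] theta_minus [of p "r - u - v - g"] theta_minus [of p "v"]
    by (simp add: algebra_simps)
  have t2: "theta p (u + g) * theta p (r - u - v) * theta p r * theta p (v + g) - theta p g * theta p (r - v) * theta p (r - u) * theta p (u + v + g)
      = theta p v * theta p (r + g) * theta p (r - u - v - g) * theta p u"
    using theta_three_term [OF p, of "u + g" "r - u - v" "- (u + v + g)" "r - v"]
      theta_minus [of p "r"] theta_minus [of p "v + g"] theta_minus [of p "r - u"] theta_minus [of p "u + v + g"] theta_minus [of p "v"] theta_minus [of p "r - u - v - g"]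
    by (simp add: algebra_simps)
  have t3: "theta p (r + v) * theta p (u + v) * theta p (r - g) * theta p (u + g) - theta p (r + v - g) * theta p (u + v + g) * theta p r * theta p u
      = theta p (r + u + v) * theta p v * theta p (r - u - g) * theta p g"
    using theta_three_term [OF p, of "r + v" "u + v" "u" "u + v + g"]
    by (simp add: algebra_simps)
  have t4: "theta p v * theta p (u + v + g) * theta p (r - g) * theta p (r - u) - theta p (v + g) * theta p (u + v) * theta p r * theta p (r - u - g)
      = - (theta p (r - u - v - g) * theta p (r + v) * theta p u * theta p g)"
    using theta_three_term [OF p, of "v" "u + v + g" "- (r - u - g)" "u + v"]
      theta_minus [of p "r - g"] theta_minus [of p "r - u"] theta_minus [of p "r"] theta_minus [of p "r - u - g"] theta_minus [of p "r - u - v - g"] theta_minus [of p "u"] theta_minus [of p "g"]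
    by (simp add: algebra_simps)
  have t5: "theta p (v + g) * theta p (r + u + v - g) * theta p (r - g) * theta p (u + g) - theta p (r + v - g) * theta p (u + v + g) * theta p g * theta p (r + u - g)
      = theta p (r + u + v) * theta p v * theta p u * theta p (r - 2 * g)"
    using theta_three_term [OF p, of "v + g" "r + u + v - g" "r + u - g" "u + v + g"]
      theta_minus [of p "u"] theta_minus [of p "r - 2 * g"]
    by (simp add: algebra_simps)
  have t6: "theta p (r + u - g) * theta p (u + v + g) * theta p r * theta p v - theta p (r + u) * theta p (u + v) * theta p (r - g) * theta p (v + g)
      = - (theta p (r + u + v) * theta p u * theta p (r - v - g) * theta p g)"
    using theta_three_term [OF p, of "r + u - g" "u + v + g" "v + g" "u + v"]
      theta_minus [of p "g"]
    by (simp add: algebra_simps)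
  \<comment> \<open>\<open>t7\<close> and \<open>t8\<close> belong together, for the diagonal entry
    of the state up, down, up. There one group of terms carries \<open>[u] [v] [u+v+g]\<close> and
    the other \<open>[g]^3\<close>; \<open>t7\<close> evaluates the cofactor of the first and
    \<open>t8\<close> that of the second, and the common factor \<open>[2r - g]\<close> makes them
    cancel.\<close>
  have t7: "theta p r * theta p (r - 2 * g) * theta p r * theta p r - theta p (r - g) * theta p (r - g) * theta p (r + g) * theta p (r - g)
      = - (theta p (2 * r - g) * theta p g * theta p g * theta p g)"
    using theta_three_term [OF p, of r "r - 2 * g" "r - g" "r - g"] theta_minus [of p g]
    by (simp add: algebra_simps)
  have t8: "theta p (r + u) * theta p (r - g) * theta p (r - u - v - g) * theta p (r + v) - theta p (r - v - g) * theta p (r + u + v) * theta p r * theta p (r - u - g)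
      = - (theta p (2 * r - g) * theta p u * theta p v * theta p (u + v + g))"
    using theta_three_term [OF p, of "r + u" "r - g" "r - u - g" "r + u + v"] theta_minus [of p v]
    by (simp add: algebra_simps)
  have args: "r - g - u = r - u - g" "r - g - v = r - v - g" "r - g - (u + v) = r - u - v - g"
     "r - (u + v) = r - u - v" "r - g + u = r + u - g" "r - g + v = r + v - g" 
     "r - g + (u + v) = r + u + v - g" "r + (u + v) = r + u + v" "r - g - g = r - 2 * g"
    by (simp_all add: algebra_simps)
  show ?thesis
    using up
    apply (cases a1; cases a2; cases a3; cases c1; cases c2; cases c3)
    apply (simp_all add: dybe_lhs_def dybe_rhs_def UNIV_bool Rmat_simps Rmat_eq_0)
    apply (simp_all add: hval_def args)
    apply (simp_all add: nz divide_simps)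
    subgoal using t1 by algebra
    subgoal using t2 by algebra
    subgoal using t3 by algebra
    subgoal using t7 t8 by algebra
    subgoal using t4 by algebra
    subgoal using t5 by algebra
    subgoal using t6 by algebra
    done
qed

lemma dybe:
  assumes p: "0 < p" "p < 1"
    and nz: "theta p r \<noteq> 0" "theta p (r - g) \<noteq> 0" "theta p (r + g) \<noteq> 0"
  shows "dybe_lhs p g u v r a1 a2 a3 c1 c2 c3 = dybe_rhs p g u v r a1 a2 a3 c1 c2 c3"
proof (cases "a1 \<and> a2 \<or> a1 \<and> a3 \<or> a2 \<and> a3")
  case True
  then show ?thesis using assms by (intro dybe_two_up)
next
  case False
  have "theta p (- r) \<noteq> 0" "theta p (- r - g) \<noteq> 0" "theta p (- r + g) \<noteq> 0"
    using nz theta_minus [of p r] theta_minus [of p "r + g"] theta_minus [of p "r - g"] by auto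
  then have "dybe_lhs p g u v (- r) (\<not> a1) (\<not> a2) (\<not> a3) (\<not> c1) (\<not> c2) (\<not> c3)
           = dybe_rhs p g u v (- r) (\<not> a1) (\<not> a2) (\<not> a3) (\<not> c1) (\<not> c2) (\<not> c3)"
    using False p by (intro dybe_two_up) auto
  then show ?thesis by (simp only: dybe_flip)
qed

section \<open>Weight conservation and the RTT relation\<close>

abbreviation wt :: "bool list \<Rightarrow> complex" where
  "wt s \<equiv> sum_list (map hval s)"

text \<open>The zero pattern of a single R-matrix (the ice rule) telescopes along the sites. This is
  what trades dynamical shifts read off one state for shifts read off another.\<close>

lemma monoT_conserves:
  assumes "monoT p g mu i x \<sigma> a c s t \<noteq> 0"
  shows "length s = length t" "hval a + wt s = hval c + wt t"
proof -
  have "length s = length t \<and> hval a + wt s = hval c + wt t"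
    using assms
  proof (induction s arbitrary: i a t)
    case Nil
    then show ?case by (cases t) (auto split: if_splits)
  next
    case (Cons e' s i a t)
    show ?case
    proof (cases t)
      case Nil
      with Cons.prems show ?thesis by simp
    next
      case t: (Cons e r)
      obtain b where b: "Rmat p g (x - mu i) (\<sigma> - g * wt s) a e' b e \<noteq> 0"
        "monoT p g mu (Suc i) x \<sigma> b c s r \<noteq> 0"
        using Cons.prems unfolding t monoT.simps
        by (metis (no_types, lifting) mult_eq_0_iff sum.not_neutral_contains_not_neutral)
      have 1: "hval a + hval e' = hval b + hval e"
        using b(1) by (cases a; cases e'; cases b; cases e) (simp_all add: Rmat_eq_0)
      have 2: "length s = length r" "hval b + wt s = hval c + wt r"
        using Cons.IH [OF b(2)] by auto
      have "hval a + wt (e' # s) = (hval a + hval e') + wt s" by simp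
      also have "\<dots> = hval e + (hval b + wt s)" unfolding 1 by simp
      also have "\<dots> = hval c + wt t" unfolding 2 t by simp
      finally show ?thesis using 2 t by simp
    qed
  qed
  then show "length s = length t" "hval a + wt s = hval c + wt t" by auto
qed

lemma finite_bool_lists: "finite {t::bool list. length t = n}"
  using finite_lists_length_eq [of "UNIV :: bool set" n] by simp

lemma sum_bool_lists_Suc:
  "(\<Sum>t\<in>{t::bool list. length t = Suc n}. F t) = (\<Sum>f\<in>UNIV. \<Sum>t\<in>{t. length t = n}. F (f # t))"
proof -
  have "(\<Sum>t\<in>{t::bool list. length t = Suc n}. F t) = (\<Sum>(f,t)\<in>UNIV \<times> {t. length t = n}. F (f # t))"
    by (rule sum.reindex_bij_witness [of _ "\<lambda>(f,t). f # t" "\<lambda>t. (hd t, tl t)"])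
       (auto simp: length_Suc_conv)
  then show ?thesis by (simp only: sum.cartesian_product)
qed

text \<open>In operator form: R12(x1-x2; \<sigma> - g h) T1(x1, \<sigma>) T2(x2, \<sigma> - g h1) =
  T2(x2, \<sigma>) T1(x1, \<sigma> - g h2) R12(x1-x2; \<sigma>), with h the total weight of the
  sites. The proof peels off the first site: the Yang-Baxter equation carries R12 through its two
  R-matrices, with that site as third factor, and the induction hypothesis carries it through the
  rest.\<close>

lemma RTT:
  assumes p: "0 < p" "p < 1"
    and nz: "\<And>m::int. \<bar>m\<bar> \<le> int (length s) \<Longrightarrow> theta p (\<sigma> + of_int m * g) \<noteq> 0"
    and len: "length r = length s"
  shows "(\<Sum>b1\<in>UNIV. \<Sum>b2\<in>UNIV. \<Sum>t\<in>{t. length t = length s}.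
            Rmat p g (x1 - x2) (\<sigma> - g * wt s) a1 a2 b1 b2
            * monoT p g mu i x1 \<sigma> b1 c1 s t * monoT p g mu i x2 (\<sigma> - g * hval c1) b2 c2 t r)
       = (\<Sum>b1\<in>UNIV. \<Sum>b2\<in>UNIV. \<Sum>t\<in>{t. length t = length s}.
            monoT p g mu i x2 \<sigma> a2 b2 s t * monoT p g mu i x1 (\<sigma> - g * hval b2) a1 b1 t r
            * Rmat p g (x1 - x2) \<sigma> b1 b2 c1 c2)"
  using nz len
proof (induction s arbitrary: i r a1 a2 c1 c2)
  case Nil
  then have [simp]: "r = []" by simp
  have "{t::bool list. length t = 0} = {[]}" by auto
  then show ?case
    by (cases c1; cases c2; cases a1; cases a2) (simp_all add: UNIV_bool)
next
  case (Cons e' s' i r0 a1 a2 c1 c2)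
  then obtain e r where r0: "r0 = e # r" and len: "length r = length s'"
    by (cases r0) auto
  let ?S = "{t::bool list. length t = length s'}"
  \<comment> \<open>The dynamical parameter at the first site, which plays the part of
    \<open>r\<close> in the Yang-Baxter equation.\<close>
  define \<rho> where "\<rho> = \<sigma> - g * wt s'"
  define u v where "u = x1 - x2" and "v = x2 - mu i"
  have uv: "x1 - mu i = x1 - x2 + (x2 - mu i)" by (simp add: u_def v_def)
  have len_Cons: "length (e' # s') = Suc (length s')" by simp
  have wt_Cons: "\<sigma> - g * wt (e' # s') = \<sigma> - g * wt s' - g * hval e'" by (simp add: algebra_simps)
  define M1 where "M1 = monoT p g mu (Suc i) x1"
  define M2 where "M2 = monoT p g mu (Suc i) x2"
  text \<open>Weight conservation turns the shift of the inner R-matrix into the one of the Yang-Baxter equation.\<close>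
  have shift: "\<sigma> - g * hval c - g * wt t = \<rho> - g * hval d"
    if "monoT p g mu j x \<sigma> d c s' t \<noteq> 0" for d c t j x
  proof -
    have "hval d + wt s' = hval c + wt t" using monoT_conserves(2) [OF that] .
    then have "g * (hval c + wt t) = g * (hval d + wt s')" by simp
    then show ?thesis by (simp add: \<rho>_def algebra_simps)
  qed
  have wt_int: "\<exists>m::int. wt s = of_int m \<and> \<bar>m\<bar> \<le> int (length s)" for s
  proof (induction s)
    case (Cons a s)
    then obtain m where "wt s = of_int m" "\<bar>m\<bar> \<le> int (length s)" by blast
    then show ?case
      by (intro exI [of _ "m + (if a then 1 else -1)"]) (cases a; auto simp: hval_def [of True] hval_def [of False])
  qed (auto intro: exI [of _ 0])
  obtain m where m: "wt s' = of_int m" "\<bar>m\<bar> \<le> int (length s')"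
    using wt_int by blast
  have nz: "theta p \<rho> \<noteq> 0" "theta p (\<rho> - g) \<noteq> 0" "theta p (\<rho> + g) \<noteq> 0"
    using Cons.prems(1) [of "- m"] Cons.prems(1) [of "- m - 1"] Cons.prems(1) [of "- m + 1"] m
    by (simp_all add: \<rho>_def algebra_simps)
  have IH: "(\<Sum>d1\<in>UNIV. \<Sum>d2\<in>UNIV. \<Sum>t\<in>?S.
            Rmat p g u \<rho> b1 b2 d1 d2 * M1 \<sigma> d1 c1 s' t * M2 (\<sigma> - g * hval c1) d2 c2 t r)
       = (\<Sum>d1\<in>UNIV. \<Sum>d2\<in>UNIV. \<Sum>t\<in>?S.
            M2 \<sigma> b2 d2 s' t * M1 (\<sigma> - g * hval d2) b1 d1 t r * Rmat p g u \<sigma> d1 d2 c1 c2)" for b1 b2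
    unfolding u_def \<rho>_def M1_def M2_def using Cons.prems len by (intro Cons.IH) auto
  have "(\<Sum>b1\<in>UNIV. \<Sum>b2\<in>UNIV. \<Sum>t\<in>{t. length t = length (e' # s')}.
            Rmat p g (x1 - x2) (\<sigma> - g * wt (e' # s')) a1 a2 b1 b2
            * monoT p g mu i x1 \<sigma> b1 c1 (e' # s') t * monoT p g mu i x2 (\<sigma> - g * hval c1) b2 c2 t r0)
     = (\<Sum>b1\<in>UNIV. \<Sum>b2\<in>UNIV. \<Sum>f\<in>UNIV. \<Sum>t\<in>?S. Rmat p g u (\<rho> - g * hval e') a1 a2 b1 b2
            * (\<Sum>d1\<in>UNIV. Rmat p g (u + v) \<rho> b1 e' d1 f * M1 \<sigma> d1 c1 s' t)
            * (\<Sum>d2\<in>UNIV. Rmat p g v (\<sigma> - g * hval c1 - g * wt t) b2 f d2 e * M2 (\<sigma> - g * hval c1) d2 c2 t r))"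
    unfolding r0 len_Cons sum_bool_lists_Suc monoT.simps wt_Cons M1_def M2_def \<rho>_def uv
    by (simp only: u_def v_def)
  also have "\<dots> = (\<Sum>b1\<in>UNIV. \<Sum>b2\<in>UNIV. \<Sum>f\<in>UNIV. \<Sum>t\<in>?S. \<Sum>d1\<in>UNIV. \<Sum>d2\<in>UNIV.
            (Rmat p g u (\<rho> - g * hval e') a1 a2 b1 b2 * Rmat p g (u + v) \<rho> b1 e' d1 f
             * Rmat p g v (\<rho> - g * hval d1) b2 f d2 e) * (M1 \<sigma> d1 c1 s' t * M2 (\<sigma> - g * hval c1) d2 c2 t r))"
    unfolding sum_distrib_left sum_distrib_right
  proof (rule sum.cong [OF refl], rule sum.cong [OF refl], rule sum.cong [OF refl], rule sum.cong [OF refl],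
      rule trans [OF sum.swap], rule sum.cong [OF refl], rule sum.cong [OF refl])
    fix b1 b2 f t d1 d2
    show "Rmat p g u (\<rho> - g * hval e') a1 a2 b1 b2 * (Rmat p g (u + v) \<rho> b1 e' d1 f * M1 \<sigma> d1 c1 s' t)
          * (Rmat p g v (\<sigma> - g * hval c1 - g * wt t) b2 f d2 e * M2 (\<sigma> - g * hval c1) d2 c2 t r)
        = Rmat p g u (\<rho> - g * hval e') a1 a2 b1 b2 * Rmat p g (u + v) \<rho> b1 e' d1 f
             * Rmat p g v (\<rho> - g * hval d1) b2 f d2 e * (M1 \<sigma> d1 c1 s' t * M2 (\<sigma> - g * hval c1) d2 c2 t r)"
      \<comment> \<open>Where the \<open>M1\<close> factor vanishes both sides are 0; elsewhere
        weight conservation identifies the two dynamical parameters.\<close>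
      using shift [of "Suc i" x1 d1 c1 t] by (cases "M1 \<sigma> d1 c1 s' t = 0") (auto simp: M1_def)
  qed
  also have "\<dots> = (\<Sum>t\<in>?S. \<Sum>d1\<in>UNIV. \<Sum>d2\<in>UNIV. dybe_lhs p g u v \<rho> a1 a2 e' d1 d2 e
        * (M1 \<sigma> d1 c1 s' t * M2 (\<sigma> - g * hval c1) d2 c2 t r))"
    unfolding dybe_lhs_def sum_distrib_right sum.cartesian_product
    by (rule sum.reindex_bij_witness [of _ "\<lambda>(t,d1,d2,b1,b2,f). (b1,b2,f,t,d1,d2)"
          "\<lambda>(b1,b2,f,t,d1,d2). (t,d1,d2,b1,b2,f)"]) auto
  also have "\<dots> = (\<Sum>t\<in>?S. \<Sum>d1\<in>UNIV. \<Sum>d2\<in>UNIV. dybe_rhs p g u v \<rho> a1 a2 e' d1 d2 e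
        * (M1 \<sigma> d1 c1 s' t * M2 (\<sigma> - g * hval c1) d2 c2 t r))"
    by (simp add: dybe [OF p nz])
  also have "\<dots> = (\<Sum>b1\<in>UNIV. \<Sum>b2\<in>UNIV. \<Sum>f\<in>UNIV. Rmat p g v \<rho> a2 e' b2 f * Rmat p g (u + v) (\<rho> - g * hval b2) a1 f b1 e
        * (\<Sum>d1\<in>UNIV. \<Sum>d2\<in>UNIV. \<Sum>t\<in>?S.
            Rmat p g u \<rho> b1 b2 d1 d2 * M1 \<sigma> d1 c1 s' t * M2 (\<sigma> - g * hval c1) d2 c2 t r))"
    unfolding dybe_rhs_def sum_distrib_right sum_distrib_left sum.cartesian_product
    by (rule sum.reindex_bij_witness [of _ "\<lambda>(b1,b2,f,d1,d2,t). (t,d1,d2,b1,b2,f)"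
          "\<lambda>(t,d1,d2,b1,b2,f). (b1,b2,f,d1,d2,t)"]) auto
  also have "\<dots> = (\<Sum>b1\<in>UNIV. \<Sum>b2\<in>UNIV. \<Sum>f\<in>UNIV. Rmat p g v \<rho> a2 e' b2 f * Rmat p g (u + v) (\<rho> - g * hval b2) a1 f b1 e
        * (\<Sum>d1\<in>UNIV. \<Sum>d2\<in>UNIV. \<Sum>t\<in>?S.
            M2 \<sigma> b2 d2 s' t * M1 (\<sigma> - g * hval d2) b1 d1 t r * Rmat p g u \<sigma> d1 d2 c1 c2))"
    unfolding IH ..
  \<comment> \<open>The same replacement in reverse, now using conservation along \<open>M2\<close>:
    the shift by \<open>b2\<close> becomes the one that the recursion of \<open>monoT\<close> for
    \<open>x1\<close> expects.\<close>
  also have "\<dots> = (\<Sum>d1\<in>UNIV. \<Sum>d2\<in>UNIV. \<Sum>f\<in>UNIV. \<Sum>t\<in>?S. \<Sum>b2\<in>UNIV. \<Sum>b1\<in>UNIV.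
           (Rmat p g v \<rho> a2 e' b2 f * M2 \<sigma> b2 d2 s' t)
           * (Rmat p g (u + v) (\<sigma> - g * hval d2 - g * wt t) a1 f b1 e * M1 (\<sigma> - g * hval d2) b1 d1 t r)
           * Rmat p g u \<sigma> d1 d2 c1 c2)"
    unfolding sum_distrib_right sum_distrib_left sum.cartesian_product
  proof (rule sum.reindex_bij_witness [of _ "\<lambda>(d1,d2,f,t,b2,b1). (b1,b2,f,d1,d2,t)"
          "\<lambda>(b1,b2,f,d1,d2,t). (d1,d2,f,t,b2,b1)"], goal_cases)
    case (5 z)
    obtain b1 b2 f d1 d2 t where [simp]: "z = (b1,b2,f,d1,d2,t)"
      by (metis surj_pair)
    show ?case
      using shift [of "Suc i" x2 b2 d2 t] by (cases "M2 \<sigma> b2 d2 s' t = 0") (auto simp: M2_def)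
  qed auto
  also have "\<dots> = (\<Sum>d1\<in>UNIV. \<Sum>d2\<in>UNIV. \<Sum>f\<in>UNIV. \<Sum>t\<in>?S.
           (\<Sum>b2\<in>UNIV. Rmat p g v \<rho> a2 e' b2 f * M2 \<sigma> b2 d2 s' t)
           * (\<Sum>b1\<in>UNIV. Rmat p g (u + v) (\<sigma> - g * hval d2 - g * wt t) a1 f b1 e * M1 (\<sigma> - g * hval d2) b1 d1 t r)
           * Rmat p g u \<sigma> d1 d2 c1 c2)"
    by (simp only: sum_product) (simp only: sum_distrib_right)
  also have "\<dots> = (\<Sum>b1\<in>UNIV. \<Sum>b2\<in>UNIV. \<Sum>t\<in>{t. length t = length (e' # s')}.
            monoT p g mu i x2 \<sigma> a2 b2 (e' # s') t * monoT p g mu i x1 (\<sigma> - g * hval b2) a1 b1 t r0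
            * Rmat p g (x1 - x2) \<sigma> b1 b2 c1 c2)"
    unfolding r0 len_Cons sum_bool_lists_Suc monoT.simps M1_def M2_def \<rho>_def uv
    by (simp only: u_def v_def)
  finally show ?case .
qed

section \<open>Exchange relations for the monodromy matrix\<close>

lemma continuous_on_Rmat:
  assumes "0 < p" "p < 1" "continuous_on S f"
  shows "continuous_on S (\<lambda>z. Rmat p g (f z) t a b c d)"
  by (cases a; cases b; cases c; cases d)
    (simp_all add: Rmat_simps Rmat_eq_0 divide_inverse, (intro continuous_intros assms)+)

lemma continuous_on_monoT:
  assumes p: "0 < p" "p < 1" and f: "continuous_on S f"
  shows "continuous_on S (\<lambda>z. monoT p g mu i (f z) \<sigma> a c s t)"
proof (induction s arbitrary: i a t)
  case Nil
  show ?case by (cases t) simp_all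
next
  case (Cons e' s)
  show ?case
  proof (cases t)
    case (Cons e r)
    show ?thesis
      unfolding Cons monoT.simps
      by (intro continuous_on_sum continuous_on_mult continuous_on_Rmat continuous_on_diff f p
          continuous_on_const Cons.IH)
  qed simp
qed

text \<open>RTT gives this relation multiplied by \<open>[x - y + g]\<close>, which may vanish; the factor is removed by
  continuity in \<open>x\<close>.\<close>

lemma monoT_B_commute:
  assumes p: "0 < p" "p < 1"
    and nz: "\<And>m::int. \<bar>m\<bar> \<le> int (length s) \<Longrightarrow> theta p (\<sigma> + of_int m * g) \<noteq> 0"
    and len: "length r = length s"
  shows "(\<Sum>t\<in>{t. length t = length s}. monoT p g mu i x \<sigma> True False s t * monoT p g mu i y (\<sigma> + g) True False t r)
       = (\<Sum>t\<in>{t. length t = length s}. monoT p g mu i y \<sigma> True False s t * monoT p g mu i x (\<sigma> + g) True False t r)"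
proof -
  define F where "F = (\<lambda>x. (\<Sum>t\<in>{t. length t = length s}. monoT p g mu i x \<sigma> True False s t * monoT p g mu i y (\<sigma> + g) True False t r)
       - (\<Sum>t\<in>{t. length t = length s}. monoT p g mu i y \<sigma> True False s t * monoT p g mu i x (\<sigma> + g) True False t r))"
  \<comment> \<open>With outer spins up, up and down, down, the R-matrix on either side of RTT
    contributes a single diagonal entry, both times \<open>[x - y + g]\<close>.\<close>
  have *: "theta p (x - y + g) * F x = 0" for x
    using RTT [OF p nz len, of x y True True mu i False False]
    by (simp add: F_def UNIV_bool Rmat_simps Rmat_eq_0 hval_def [of False] sum_distrib_left [symmetric]
        sum_distrib_right [symmetric] mult.assoc algebra_simps)
  \<comment> \<open>The substitution \<open>x = z + y - g\<close> turns the factor to be removed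
    into \<open>[z]\<close>, which is nonzero on a dense set.\<close>
  have "F (z + y - g) = 0" for z
  proof (rule continuous_constant_on_closure [where S = "{z. theta p z \<noteq> 0}" and f = "\<lambda>z. F (z + y - g)"])
    show "F (z + y - g) = 0" if "z \<in> {z. theta p z \<noteq> 0}" for z
      using * [of "z + y - g"] that by simp
    show "continuous_on (closure {z. theta p z \<noteq> 0}) (\<lambda>z. F (z + y - g))"
      unfolding F_def by (intro continuous_on_sum continuous_on_mult continuous_on_diff continuous_on_add
          continuous_on_monoT continuous_on_const continuous_on_id p)
    have "closure {z. theta p z \<noteq> 0} = UNIV"
      using nz [of 0] by (intro closure_theta_nonzero [OF p, of \<sigma>]) simp
    then show "z \<in> closure {z. theta p z \<noteq> 0}" by simp
  qed
  from this [of "x - y + g"] show ?thesis by (simp add: F_def)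
qed

text \<open>The RTT entry with auxiliary spins down, up on the left and down, down on the right. The
  left R-matrix contributes a diagonal and an off-diagonal entry, the latter giving the unwanted
  term; the right one contributes only \<open>[y - x + g]\<close>.\<close>

lemma monoT_D_B_exchange:
  assumes p: "0 < p" "p < 1"
    and nz: "\<And>m::int. \<bar>m\<bar> \<le> int (length s) \<Longrightarrow> theta p (\<sigma> + of_int m * g) \<noteq> 0"
    and len: "length r = length s"
    and t: "t = \<sigma> - g * wt s"
  shows "theta p (t + g) * theta p (y - x) / theta p t
       * (\<Sum>q\<in>{q. length q = length s}. monoT p g mu i y \<sigma> False False s q * monoT p g mu i x (\<sigma> + g) True False q r)
     + theta p (t + (y - x)) * theta p g / theta p t
       * (\<Sum>q\<in>{q. length q = length s}. monoT p g mu i y \<sigma> True False s q * monoT p g mu i x (\<sigma> + g) False False q r)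
     = theta p (y - x + g)
       * (\<Sum>q\<in>{q. length q = length s}. monoT p g mu i x \<sigma> True False s q * monoT p g mu i y (\<sigma> + g) False False q r)"
  using RTT [OF p nz len, of y x False True mu i False False]
  unfolding t [symmetric]
  by (simp add: UNIV_bool Rmat_simps Rmat_eq_0 hval_def [of False] sum_distrib_left sum_distrib_right mult_ac)

text \<open>With all incoming spins up, the auxiliary spin has to stay down at every site. A site
  with \<open>m\<close> sites to its right contributes
  \<open>[\<sigma> - m g + g] / [\<sigma> - m g]\<close> times \<open>[x - \<mu>]\<close>, and the
  dynamical quotients telescope.\<close>

lemma monoT_D_vacuum:
  assumes nz: "\<And>m::int. - int n \<le> m \<Longrightarrow> m \<le> 1 \<Longrightarrow> theta p (\<sigma> + of_int m * g) \<noteq> 0"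
    and len: "length s = n"
  shows "monoT p g mu i x \<sigma> False False s (replicate n True)
     = (if s = replicate n True then theta p (\<sigma> + g) / theta p (\<sigma> - (of_nat n - 1) * g)
          * (\<Prod>j\<in>{i..<i+n}. theta p (x - mu j)) else 0)"
  using assms
proof (induction n arbitrary: s i)
  \<comment> \<open>Here the quotient is \<open>[\<sigma> + g] / [\<sigma> + g]\<close>, so the
    shift 1 must belong to the nonvanishing range.\<close>
  case 0
  then show ?case using 0(1) [of 1] by simp
next
  case (Suc n)
  then obtain e s' where s: "s = e # s'" and len: "length s' = n" by (cases s) auto
  have IH: "monoT p g mu (Suc i) x \<sigma> False False s' (replicate n True)
     = (if s' = replicate n True then theta p (\<sigma> + g) / theta p (\<sigma> - (of_nat n - 1) * g)
          * (\<Prod>j\<in>{Suc i..<Suc i+n}. theta p (x - mu j)) else 0)"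
    using Suc.prems len by (intro Suc.IH) auto
  have step: "monoT p g mu i x \<sigma> False False s (replicate (Suc n) True)
    = Rmat p g (x - mu i) (\<sigma> - g * wt s') False e False True * monoT p g mu (Suc i) x \<sigma> False False s' (replicate n True)"
    by (cases e) (simp_all add: s UNIV_bool Rmat_eq_0)
  have val: "theta p (\<sigma> - g * wt s' + g) * theta p (x - mu i) / theta p (\<sigma> - g * wt s')
      * (theta p (\<sigma> + g) / theta p (\<sigma> - (of_nat n - 1) * g) * (\<Prod>j\<in>{Suc i..<Suc i+n}. theta p (x - mu j)))
      = theta p (\<sigma> + g) / theta p (\<sigma> - (of_nat (Suc n) - 1) * g) * (\<Prod>j\<in>{i..<i+Suc n}. theta p (x - mu j))"
    if "s' = replicate n True"
  proof -
    have 1: "\<sigma> - (of_nat (Suc n) - 1) * g + g = \<sigma> - (of_nat n - 1) * g" "\<sigma> - g * wt s' = \<sigma> - (of_nat (Suc n) - 1) * g"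
      using that by (simp_all add: hval_def sum_list_replicate algebra_simps)
    have 2: "theta p (\<sigma> - (of_nat n - 1) * g) \<noteq> 0"
      using Suc.prems(1) [of "1 - int n"] by (simp add: algebra_simps)
    have 3: "(\<Prod>j\<in>{i..<i+Suc n}. theta p (x - mu j)) = theta p (x - mu i) * (\<Prod>j\<in>{Suc i..<Suc i+n}. theta p (x - mu j))"
      by (subst prod.atLeast_Suc_lessThan) auto
    have "A * b / C * (D / A * P) = D / C * (b * P)" if "A \<noteq> 0" for A b C D P :: complex
      using that by simp
    from this [OF 2] show ?thesis unfolding 3 by (simp only: 1)
  qed
  show ?case
  proof (cases "e \<and> s' = replicate n True")
    case True
    have s_eq: "s = replicate (Suc n) True" using True s by simp
    have R_eq: "Rmat p g (x - mu i) (\<sigma> - g * wt s') False e False True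
        = theta p (\<sigma> - g * wt s' + g) * theta p (x - mu i) / theta p (\<sigma> - g * wt s')"
      using True by (simp only: Rmat_simps)
    show ?thesis
      unfolding step IH R_eq if_P [OF s_eq] if_P [OF conjunct2 [OF True]]
      using True by (intro val) simp
  next
    case False
    then have "s \<noteq> replicate (Suc n) True" using s by auto
    then show ?thesis using False unfolding step IH by (cases e) (auto simp: Rmat_eq_0)
  qed
qed

text \<open>Equal outgoing spins allow only the diagonal entry of the R-matrix, which is free of the
  dynamical parameter; hence no quotient appears.\<close>

lemma monoT_D_dual_vacuum:
  assumes "length t = n"
  shows "monoT p g mu i x \<sigma> False False (replicate n False) t
     = (if t = replicate n False then \<Prod>j\<in>{i..<i+n}. theta p (x - mu j + g) else 0)"
  using assms
proof (induction n arbitrary: t i)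
  case (Suc n)
  then obtain e r where t: "t = e # r" and len: "length r = n" by (cases t) auto
  have "(\<Prod>j\<in>{i..<i+Suc n}. theta p (x - mu j + g)) = theta p (x - mu i + g) * (\<Prod>j\<in>{Suc i..<Suc i+n}. theta p (x - mu j + g))"
    by (subst prod.atLeast_Suc_lessThan) auto
  then show ?case
    using Suc.IH [OF len, of "Suc i"] by (cases e) (simp_all add: t UNIV_bool Rmat_eq_0 Rmat_simps)
qed simp

section \<open>The operator D acting on products of B\<close>

text \<open>Each B turns one spin down, so the weight of a contributing state counts the B's. This
  makes the coefficients in the expansion of D independent of the state.\<close>

lemma chainB_nonzeroD:
  assumes "chainB p g mu L tau k xs s \<noteq> 0"
  shows "length s = L" "wt s = of_nat L - 2 * of_nat (length xs)"
proof -
  have "length s = L \<and> wt s = of_nat L - 2 * of_nat (length xs)"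
    using assms
  proof (induction xs arbitrary: k s)
    case Nil
    then show ?case by (auto simp: sum_list_replicate hval_def split: if_splits)
  next
    case (Cons x xs)
    obtain t where t: "Bop p g mu x (tau + of_nat k * g) s t \<noteq> 0" "chainB p g mu L tau (Suc k) xs t \<noteq> 0"
      using Cons.prems unfolding chainB.simps
      by (metis (no_types, lifting) mult_eq_0_iff sum.not_neutral_contains_not_neutral)
    have "hval True = 1" "hval False = -1" by (simp_all add: hval_def)
    then have "length s = length t" "1 + wt s = -1 + wt t"
      using monoT_conserves [OF t(1) [unfolded Bop_def]] by simp_all
    moreover have "length t = L" "wt t = of_nat L - 2 * of_nat (length xs)"
      using Cons.IH [OF t(2)] by auto
    ultimately show ?case by (simp add: algebra_simps)
  qed
  then show "length s = L" "wt s = of_nat L - 2 * of_nat (length xs)" by auto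
qed

text \<open>Here \<open>k\<close> is the level of a monodromy matrix and \<open>m\<close> a shift by
  the weight of a state.\<close>

lemma theta_shift_nonzero:
  assumes gen: "\<And>m::int. \<bar>m\<bar> \<le> 2 * int L + 2 \<Longrightarrow> theta p (tau + of_int m * g) \<noteq> 0"
    and "\<bar>m\<bar> + int k \<le> 2 * int L + 2"
  shows "theta p (tau + of_nat k * g + of_int m * g) \<noteq> 0"
proof -
  have eq: "tau + of_nat k * g + of_int m * g = tau + of_int (int k + m) * g"
    by (simp add: algebra_simps)
  show ?thesis
    unfolding eq using assms(2) by (intro gen) linarith
qed

lemma chainB_swap:
  assumes p: "0 < p" "p < 1"
    and gen: "\<And>m::int. \<bar>m\<bar> \<le> 2 * int L + 2 \<Longrightarrow> theta p (tau + of_int m * g) \<noteq> 0"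
    and k: "k \<le> L + 2"
  shows "chainB p g mu L tau k (x # y # zs) s = chainB p g mu L tau k (y # x # zs) s"
proof (cases "length s = L")
  case False
  then show ?thesis using chainB_nonzeroD(1) by metis
next
  case True
  let ?S = "{t::bool list. length t = L}"
  have shift: "tau + of_nat (Suc k) * g = tau + of_nat k * g + g" by (simp add: algebra_simps)
  have nz: "theta p (tau + of_nat k * g + of_int m * g) \<noteq> 0" if "\<bar>m\<bar> \<le> int (length s)" for m
    by (rule theta_shift_nonzero [OF gen]) (use that True k in auto)
  have *: "chainB p g mu L tau k (x # y # zs) s = (\<Sum>r\<in>?S.
      (\<Sum>t\<in>?S. monoT p g mu 1 x (tau + of_nat k * g) True False s t * monoT p g mu 1 y (tau + of_nat k * g + g) True False t r)
      * chainB p g mu L tau (Suc (Suc k)) zs r)" for x y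
    unfolding chainB.simps Bop_def shift sum_distrib_left sum_distrib_right
    by (subst sum.swap) (simp only: mult.assoc)
  show ?thesis
    unfolding *
  proof (rule sum.cong [OF refl], rule arg_cong2 [of _ _ _ _ "(*)", OF _ refl])
    fix r :: "bool list"
    assume "r \<in> ?S"
    then show "(\<Sum>t\<in>?S. monoT p g mu 1 x (tau + of_nat k * g) True False s t * monoT p g mu 1 y (tau + of_nat k * g + g) True False t r)
      = (\<Sum>t\<in>?S. monoT p g mu 1 y (tau + of_nat k * g) True False s t * monoT p g mu 1 x (tau + of_nat k * g + g) True False t r)"
      unfolding True [symmetric] by (intro monoT_B_commute p nz) simp_all
  qed
qed

text \<open>The symmetry of products of B in the form in which unwanted terms are compared: the head
  is moved to position \<open>i\<close> by adjacent swaps.\<close>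

lemma chainB_exchange:
  assumes p: "0 < p" "p < 1"
    and gen: "\<And>m::int. \<bar>m\<bar> \<le> 2 * int L + 2 \<Longrightarrow> theta p (tau + of_int m * g) \<noteq> 0"
    and "k + length zs \<le> L + 2" "i < length zs"
  shows "chainB p g mu L tau k (x # zs[i := y]) s = chainB p g mu L tau k (y # zs[i := x]) s"
  using assms(4,5)
proof (induction zs arbitrary: i k s)
  case (Cons z zs)
  have cong: "chainB p g mu L tau k (w # us) s = chainB p g mu L tau k (w # vs) s"
    if "\<And>t. chainB p g mu L tau (Suc k) us t = chainB p g mu L tau (Suc k) vs t" for w us vs s
    using that by simp
  show ?case
  proof (cases i)
    case 0
    then show ?thesis using chainB_swap [OF p gen, where mu = mu and k = k] Cons.prems by simp
  next
    case (Suc j)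
    have IH: "chainB p g mu L tau (Suc k) (x # zs[j := y]) t = chainB p g mu L tau (Suc k) (y # zs[j := x]) t" for t
      using Cons.prems Suc by (intro Cons.IH) auto
    have "chainB p g mu L tau k (x # z # zs[j := y]) s = chainB p g mu L tau k (z # x # zs[j := y]) s"
      using Cons.prems by (intro chainB_swap [OF p gen]) auto
    also have "\<dots> = chainB p g mu L tau k (z # y # zs[j := x]) s"
      by (intro cong IH)
    also have "\<dots> = chainB p g mu L tau k (y # z # zs[j := x]) s"
      using Cons.prems by (intro chainB_swap [OF p gen]) auto
    finally show ?thesis using Suc by simp
  qed
qed simp

definition D_chainB :: "real \<Rightarrow> complex \<Rightarrow> (nat \<Rightarrow> complex) \<Rightarrow> nat \<Rightarrow> complex \<Rightarrow> complex \<Rightarrow> nat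
    \<Rightarrow> complex list \<Rightarrow> bool list \<Rightarrow> complex" where
  "D_chainB p g mu L tau y k xs s = (\<Sum>t\<in>{t. length t = L}.
     monoT p g mu 1 y (tau + of_nat k * g) False False s t * chainB p g mu L tau (Suc k) xs t)"

lemma D_chainB_exchange:
  assumes p: "0 < p" "p < 1"
    and gen: "\<And>m::int. \<bar>m\<bar> \<le> 2 * int L + 2 \<Longrightarrow> theta p (tau + of_int m * g) \<noteq> 0"
    and k: "k \<le> L + 2" and len: "length s = L" and t: "t = tau + of_nat k * g - g * wt s"
  shows "theta p (t + g) * theta p (y - x) / theta p t * D_chainB p g mu L tau y k (x # xs) s
     + theta p (t + (y - x)) * theta p g / theta p t
       * (\<Sum>q\<in>{q. length q = L}. Bop p g mu y (tau + of_nat k * g) s q * D_chainB p g mu L tau x (Suc k) xs q)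
     = theta p (y - x + g)
       * (\<Sum>q\<in>{q. length q = L}. Bop p g mu x (tau + of_nat k * g) s q * D_chainB p g mu L tau y (Suc k) xs q)"
proof -
  let ?S = "{t::bool list. length t = L}"
  let ?\<sigma> = "tau + of_nat k * g"
  have shift: "tau + of_nat (Suc k) * g = tau + of_nat k * g + g" by (simp add: algebra_simps)
  have nz: "theta p (tau + of_nat k * g + of_int m * g) \<noteq> 0" if "\<bar>m\<bar> \<le> int (length s)" for m
    by (rule theta_shift_nonzero [OF gen]) (use that len k in auto)
  define W where "W = chainB p g mu L tau (Suc (Suc k)) xs"
  have swap: "(\<Sum>q\<in>?S. f q * (\<Sum>r\<in>?S. h q r * W r)) = (\<Sum>r\<in>?S. (\<Sum>q\<in>?S. f q * h q r) * W r)" for f h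
    unfolding sum_distrib_left sum_distrib_right by (subst sum.swap) (simp only: mult.assoc)
  have lin: "a * (\<Sum>r\<in>?S. f r * W r) + b * (\<Sum>r\<in>?S. h r * W r) = c * (\<Sum>r\<in>?S. m r * W r)"
    if "\<And>r. r \<in> ?S \<Longrightarrow> a * f r + b * h r = c * m r" for a b c f h m
    unfolding sum_distrib_left sum.distrib [symmetric]
    by (intro sum.cong refl) (simp only: mult.assoc [symmetric] distrib_right [symmetric] that)
  show ?thesis
    unfolding D_chainB_def chainB.simps Bop_def shift W_def [symmetric] swap
  proof (intro lin)
    fix r :: "bool list"
    assume "r \<in> ?S"
    then show "theta p (t + g) * theta p (y - x) / theta p t
        * (\<Sum>q\<in>?S. monoT p g mu 1 y ?\<sigma> False False s q * monoT p g mu 1 x (?\<sigma> + g) True False q r)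
      + theta p (t + (y - x)) * theta p g / theta p t
        * (\<Sum>q\<in>?S. monoT p g mu 1 y ?\<sigma> True False s q * monoT p g mu 1 x (?\<sigma> + g) False False q r)
      = theta p (y - x + g)
        * (\<Sum>q\<in>?S. monoT p g mu 1 x ?\<sigma> True False s q * monoT p g mu 1 y (?\<sigma> + g) False False q r)"
      unfolding len [symmetric] by (intro monoT_D_B_exchange p nz t) simp_all
  qed
qed

lemma D_chainB_eq_0:
  assumes "wt s \<noteq> of_nat L - 2 * of_nat (length xs)"
  shows "D_chainB p g mu L tau y k xs s = 0"
  unfolding D_chainB_def
proof (intro sum.neutral ballI)
  fix t
  show "monoT p g mu 1 y (tau + of_nat k * g) False False s t * chainB p g mu L tau (Suc k) xs t = 0"
    using monoT_conserves(2) [of p g mu 1 y "tau + of_nat k * g" False False s t]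
      chainB_nonzeroD(2) [of p g mu L tau "Suc k" xs t] assms
    by (metis add_left_cancel mult_eq_0_iff)
qed

text \<open>The argument \<open>z\<close> can be lost in two ways: D(y) passes x and is then
  exchanged with z, or D takes over x first and then loses it to z. By the three-term relation the
  two coefficients merge, and the only trace of \<open>x\<close> is the factor
  \<open>[z - x + g] / [z - x]\<close>.\<close>

lemma theta_exchange_coefficients:
  assumes p: "0 < p" "p < 1"
    and nz: "theta p t \<noteq> 0" "theta p (t - g) \<noteq> 0" "theta p (y - z) \<noteq> 0" "theta p (x - z) \<noteq> 0"
  shows "theta p (y - x) * (theta p g * theta p (t + (y - z)) / (theta p t * theta p (y - z))
          * (theta p (z - x + g) / theta p (z - x)))
       = theta p (y - x + g) * (theta p g * theta p (t - g + (y - z)) / (theta p (t - g) * theta p (y - z)))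
         - theta p (t + (y - x)) * theta p g / theta p t
           * (theta p g * theta p (t - g + (x - z)) / (theta p (t - g) * theta p (x - z)))"
proof -
  have "theta p (t - g + (y - z)) * theta p t * theta p (y - x + g) * theta p (x - z)
      - theta p (t + (y - x)) * theta p (t - g + (x - z)) * theta p (y - z) * theta p g
      = theta p (t + (y - z)) * theta p (t - g) * theta p (y - x) * theta p (x - z - g)"
    using theta_three_term [OF p, of "t - g + (y - z)" t g "t - g + (x - z)"] by (simp add: algebra_simps)
  moreover have "theta p (z - x + g) / theta p (z - x) = theta p (x - z - g) / theta p (x - z)"
    using theta_minus [of p "x - z - g"] theta_minus [of p "x - z"] by (simp add: algebra_simps)
  moreover have "Yx * (G * B / (T * Yz) * (K / Xz)) = Yg * (G * A / (S * Yz)) - C * G / T * (G * F / (S * Xz))"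
    if "A * T * Yg * Xz - C * F * Yz * G = B * S * Yx * K" "T \<noteq> 0" "S \<noteq> 0" "Yz \<noteq> 0" "Xz \<noteq> 0"
    for A B C F G K S T Xz Yg Yx Yz :: complex
  proof -
    have "Yx * (G * B / (T * Yz) * (K / Xz)) = G * (B * S * Yx * K) / (T * S * Yz * Xz)"
      using that(2-) by (simp add: mult_ac)
    also have "\<dots> = Yg * (G * A / (S * Yz)) - C * G / T * (G * F / (S * Xz))"
      unfolding that(1) [symmetric] using that(2-) by (simp add: field_simps)
    finally show ?thesis .
  qed
  ultimately show ?thesis using nz by metis
qed

text \<open>The exchange relation solved for the value \<open>D\<close>. Here \<open>T\<close>,
  \<open>U\<close>, \<open>Y\<close>, \<open>K\<close>, \<open>H\<close>, \<open>G\<close> stand for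
  \<open>[t]\<close>, \<open>[t + g]\<close>, \<open>[y - x]\<close>, \<open>[y - x + g]\<close>,
  \<open>[t + (y - x)]\<close>, \<open>[g]\<close>; \<open>A\<close> and \<open>B\<close> are the
  unwanted sums of D(y) and D(x), and \<open>E\<close> is their merged form.\<close>

lemma exchange_solve:
  fixes D :: complex
  assumes nz: "T \<noteq> 0" "U \<noteq> 0" "Y \<noteq> 0"
    and exch: "U * Y / T * D + H * G / T * (Q / T * (X - B)) = K * (Q / T * (Z - A))"
    and E: "Y * E = K * A - H * G / T * B"
  shows "D = Q / U * (K / Y * Z - (G * H / (T * Y) * X + E))"
proof -
  have "U * Y / T * D = K * (Q / T * (Z - A)) - H * G / T * (Q / T * (X - B))"
    using exch by (simp only: eq_diff_eq)
  then have "T * (U * Y / T * D) = T * (K * (Q / T * (Z - A)) - H * G / T * (Q / T * (X - B)))"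
    by (rule arg_cong)
  moreover have "T * (U * Y / T * D) = U * Y * D"
    using nz by simp
  moreover have "T * (K * (Q / T * (Z - A)) - H * G / T * (Q / T * (X - B)))
      = K * Q * (Z - A) - H * G / T * Q * (X - B)"
    using nz by (simp add: field_simps)
  ultimately have "U * Y * D = K * Q * (Z - A) - H * G / T * Q * (X - B)"
    by (simp only:)
  also have "\<dots> = Q * (K * Z - H * G / T * X - Y * E)"
    unfolding E by (simp add: algebra_simps diff_divide_distrib)
  finally show ?thesis using nz by (simp add: field_simps)
qed

text \<open>The factor in front is 1 for \<open>k = 1\<close> and \<open>length xs = L\<close>.\<close>

lemma D_chainB_expand:
  assumes p: "0 < p" "p < 1"
    and gen: "\<And>m::int. \<bar>m\<bar> \<le> 2 * int L + 2 \<Longrightarrow> theta p (tau + of_int m * g) \<noteq> 0"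
    and k: "1 \<le> k" "k + length xs \<le> L + 1"
    and y: "\<And>x. x \<in> set xs \<Longrightarrow> theta p (y - x) \<noteq> 0"
    and xs: "\<And>i j. i < length xs \<Longrightarrow> j < length xs \<Longrightarrow> i \<noteq> j \<Longrightarrow> theta p (xs ! i - xs ! j) \<noteq> 0"
    and len: "length s = L"
    and t: "t = tau + of_int (int k + 2 * int (length xs) - int L) * g"
  shows "D_chainB p g mu L tau y k xs s = theta p (tau + of_nat (k + length xs + 1) * g) / theta p (t + g)
     * ((\<Prod>j=1..L. theta p (y - mu j)) * (\<Prod>i<length xs. theta p (y - xs ! i + g) / theta p (y - xs ! i))
          * chainB p g mu L tau k xs s
        - (\<Sum>i<length xs. theta p g * theta p (t + (y - xs ! i)) / (theta p t * theta p (y - xs ! i))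
            * (\<Prod>j=1..L. theta p (xs ! i - mu j))
            * (\<Prod>j\<in>{..<length xs} - {i}. theta p (xs ! i - xs ! j + g) / theta p (xs ! i - xs ! j))
            * chainB p g mu L tau k (xs[i := y]) s))"
  using k y xs len t
proof (induction xs arbitrary: y k s t)
  case (Nil y k s t)
  have nz: "theta p (tau + of_nat k * g + of_int m * g) \<noteq> 0" if "- int L \<le> m" "m \<le> 1" for m
    by (rule theta_shift_nonzero [OF gen]) (use that Nil(1,2) in auto)
  have "D_chainB p g mu L tau y k [] s = monoT p g mu 1 y (tau + of_nat k * g) False False s (replicate L True)"
    by (simp add: D_chainB_def finite_bool_lists if_distrib sum.delta cong: if_cong)
  also have "\<dots> = (if s = replicate L True then theta p (tau + of_nat k * g + g) / theta p (tau + of_nat k * g - (of_nat L - 1) * g)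
          * (\<Prod>j\<in>{1..<1+L}. theta p (y - mu j)) else 0)"
    using nz Nil.prems by (intro monoT_D_vacuum) auto
  \<comment> \<open>With no B left, \<open>t + g\<close> is the last denominator of the telescoped
    vacuum eigenvalue.\<close>
  also have "tau + of_nat k * g - (of_nat L - 1) * g = t + g"
    using Nil.prems by (simp add: algebra_simps)
  also have "tau + of_nat k * g + g = tau + of_nat (k + 1) * g"
    by (simp add: algebra_simps)
  also have "{1..<1+L} = {1..L}" by auto
  finally show ?case by simp
next
  case (Cons x zs y k s t)
  define n where "n = length zs"
  define \<sigma> where "\<sigma> = tau + of_nat k * g"
  let ?S = "{t::bool list. length t = L}"
  let ?Q = "theta p (tau + of_nat (k + n + 2) * g)"
  \<comment> \<open>States of the wrong weight make both sides vanish; for the right weight,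
    \<open>t\<close> is the dynamical parameter of the exchange relation.\<close>
  show ?case
  proof (cases "wt s = of_nat L - 2 * of_nat (length (x # zs))")
    case False
    then have "chainB p g mu L tau k us s = 0" if "length us = length (x # zs)" for us
      using chainB_nonzeroD(2) [of p g mu L tau k us s] that by metis
    then have zero: "chainB p g mu L tau k (x # zs) s = 0" "chainB p g mu L tau k ((x # zs)[i := y]) s = 0" for i
      by (blast, metis length_list_update)
    show ?thesis
      unfolding D_chainB_eq_0 [OF False] zero by (simp only: mult_zero_right sum.neutral_const diff_0_right)
  next
    case True
    have t_wt: "t = tau + of_nat k * g - g * wt s"
      unfolding True Cons.prems(6) by (simp add: algebra_simps)
    have t_nz: "theta p (t + of_int m * g) \<noteq> 0" if "\<bar>m\<bar> \<le> 1" for m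
    proof -
      have "t + of_int m * g = tau + of_int (int k + 2 * int (length (x # zs)) - int L + m) * g"
        unfolding Cons.prems(6) by (simp add: algebra_simps)
      moreover have "\<bar>int k + 2 * int (length (x # zs)) - int L + m\<bar> \<le> 2 * int L + 2"
        using Cons.prems(1,2) that by auto
      ultimately show ?thesis using gen by metis
    qed
    have nz: "theta p t \<noteq> 0" "theta p (t - g) \<noteq> 0" "theta p (t + g) \<noteq> 0" "theta p (y - x) \<noteq> 0"
      using t_nz [of 0] t_nz [of "-1"] t_nz [of 1] Cons.prems(3) by auto
    have x_nz: "theta p (x - zs ! i) \<noteq> 0" if "i < n" for i
      using Cons.prems(4) [of 0 "Suc i"] that by (simp add: n_def)
    have y_nz: "theta p (y - zs ! i) \<noteq> 0" if "i < n" for i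
      using Cons.prems(3) that by (simp add: n_def)
    define M where "M = (\<lambda>w. \<Prod>j=1..L. theta p (w - mu j))"
    define P where "P = (\<lambda>w. \<Prod>i<n. theta p (w - zs ! i + g) / theta p (w - zs ! i))"
    define R where "R = (\<lambda>i. \<Prod>j\<in>{..<n} - {i}. theta p (zs ! i - zs ! j + g) / theta p (zs ! i - zs ! j))"
    define c where "c = (\<lambda>w i. theta p g * theta p (t - g + (w - zs ! i)) / (theta p (t - g) * theta p (w - zs ! i))
      * M (zs ! i) * R i)"
    have IH: "D_chainB p g mu L tau w (Suc k) zs q = ?Q / theta p t
      * (M w * P w * chainB p g mu L tau (Suc k) zs q - (\<Sum>i<n. c w i * chainB p g mu L tau (Suc k) (zs[i := w]) q))"
      if "w \<in> {x, y}" "q \<in> ?S" for w q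
    proof -
      have "theta p (w - z) \<noteq> 0" if "z \<in> set zs" for z
        using that \<open>w \<in> {x, y}\<close> x_nz Cons.prems(3) by (auto simp: in_set_conv_nth n_def)
      moreover have "theta p (zs ! i - zs ! j) \<noteq> 0" if "i < length zs" "j < length zs" "i \<noteq> j" for i j
        using Cons.prems(4) [of "Suc i" "Suc j"] that by simp
      \<comment> \<open>One B fewer and one level more lower \<open>t\<close> by \<open>g\<close>,
        while \<open>k\<close> plus the length is unchanged: the numerator \<open>?Q\<close> is the
        same for the tail and the denominator becomes \<open>[t]\<close>.\<close>
      moreover have "t - g = tau + of_int (int (Suc k) + 2 * int (length zs) - int L) * g"
        using Cons.prems(6) by (simp add: algebra_simps)
      ultimately have "D_chainB p g mu L tau w (Suc k) zs q
        = theta p (tau + of_nat (Suc k + length zs + 1) * g) / theta p (t - g + g)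
     * ((\<Prod>j=1..L. theta p (w - mu j)) * (\<Prod>i<length zs. theta p (w - zs ! i + g) / theta p (w - zs ! i))
          * chainB p g mu L tau (Suc k) zs q
        - (\<Sum>i<length zs. theta p g * theta p (t - g + (w - zs ! i)) / (theta p (t - g) * theta p (w - zs ! i))
            * (\<Prod>j=1..L. theta p (zs ! i - mu j))
            * (\<Prod>j\<in>{..<length zs} - {i}. theta p (zs ! i - zs ! j + g) / theta p (zs ! i - zs ! j))
            * chainB p g mu L tau (Suc k) (zs[i := w]) q))"
        using Cons.prems(2) \<open>q \<in> ?S\<close> by (intro Cons.IH) auto
      moreover have "Suc k + length zs + 1 = k + n + 2" by (simp add: n_def)
      ultimately show ?thesis
        unfolding M_def P_def c_def R_def n_def by (simp only: diff_add_cancel)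
    qed
    have B_D: "(\<Sum>q\<in>?S. Bop p g mu w' \<sigma> s q * D_chainB p g mu L tau w (Suc k) zs q)
      = ?Q / theta p t * (M w * P w * chainB p g mu L tau k (w' # zs) s
          - (\<Sum>i<n. c w i * chainB p g mu L tau k (w' # zs[i := w]) s))"
      if "w \<in> {x, y}" for w w'
    proof -
      have "(\<Sum>q\<in>?S. Bop p g mu w' \<sigma> s q * D_chainB p g mu L tau w (Suc k) zs q)
         = (\<Sum>q\<in>?S. ?Q / theta p t * (M w * P w * (Bop p g mu w' \<sigma> s q * chainB p g mu L tau (Suc k) zs q)
          - (\<Sum>i<n. c w i * (Bop p g mu w' \<sigma> s q * chainB p g mu L tau (Suc k) (zs[i := w]) q))))"
        by (intro sum.cong refl) (simp add: IH [OF that] right_diff_distrib sum_distrib_left mult_ac)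
      also have "\<dots> = ?Q / theta p t * (M w * P w * (\<Sum>q\<in>?S. Bop p g mu w' \<sigma> s q * chainB p g mu L tau (Suc k) zs q)
          - (\<Sum>i<n. c w i * (\<Sum>q\<in>?S. Bop p g mu w' \<sigma> s q * chainB p g mu L tau (Suc k) (zs[i := w]) q)))"
        unfolding sum_distrib_left [symmetric] sum_subtractf
        by (subst sum.swap) (simp only: sum_distrib_left)
      finally show ?thesis by (simp only: chainB.simps \<sigma>_def)
    qed
    define W where "W = chainB p g mu L tau k (x # zs) s"
    define Y where "Y = chainB p g mu L tau k (y # zs) s"
    define V where "V = (\<lambda>i. chainB p g mu L tau k (x # zs[i := y]) s)"
    have V_fold: "chainB p g mu L tau k (x # zs[i := y]) s = V i" for i
      by (simp only: V_def)
    \<comment> \<open>D(x) leaves y in front and x at position \<open>i\<close>, D(y) leaves x in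
      front and y at position \<open>i\<close>; by symmetry these are the same vector.\<close>
    have V: "chainB p g mu L tau k (y # zs[i := x]) s = V i" if "i < n" for i
      unfolding V_def using Cons.prems(2) that
      by (intro chainB_exchange [OF p gen, symmetric]) (auto simp: n_def)
    have sum_V: "(\<Sum>i<n. c x i * chainB p g mu L tau k (y # zs[i := x]) s) = (\<Sum>i<n. c x i * V i)"
      by (intro sum.cong refl) (simp only: V lessThan_iff)
    have "theta p (t + g) * theta p (y - x) / theta p t * D_chainB p g mu L tau y k (x # zs) s
     + theta p (t + (y - x)) * theta p g / theta p t
       * (\<Sum>q\<in>?S. Bop p g mu y \<sigma> s q * D_chainB p g mu L tau x (Suc k) zs q)
     = theta p (y - x + g) * (\<Sum>q\<in>?S. Bop p g mu x \<sigma> s q * D_chainB p g mu L tau y (Suc k) zs q)"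
      unfolding \<sigma>_def using Cons.prems by (intro D_chainB_exchange p gen t_wt) auto
    then have exch: "theta p (t + g) * theta p (y - x) / theta p t * D_chainB p g mu L tau y k (x # zs) s
     + theta p (t + (y - x)) * theta p g / theta p t * (?Q / theta p t * (M x * P x * Y - (\<Sum>i<n. c x i * V i)))
     = theta p (y - x + g) * (?Q / theta p t * (M y * P y * W - (\<Sum>i<n. c y i * V i)))"
      by (simp only: B_D insert_iff simp_thms sum_V W_def [symmetric] Y_def [symmetric] V_fold)
    \<comment> \<open>The coefficient claimed for position \<open>Suc i\<close> of
      \<open>x # zs\<close>: the product over the other arguments has gained the factor of
      \<open>x\<close>.\<close>
    define E where "E = (\<lambda>i. theta p g * theta p (t + (y - zs ! i)) / (theta p t * theta p (y - zs ! i))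
      * M (zs ! i) * (theta p (zs ! i - x + g) / theta p (zs ! i - x) * R i))"
    have "theta p (y - x) * E i = theta p (y - x + g) * c y i - theta p (t + (y - x)) * theta p g / theta p t * c x i"
      if "i < n" for i
    proof -
      have "theta p (y - x) * E i = theta p (y - x) * (theta p g * theta p (t + (y - zs ! i)) / (theta p t * theta p (y - zs ! i))
          * (theta p (zs ! i - x + g) / theta p (zs ! i - x))) * (M (zs ! i) * R i)"
        unfolding E_def by (simp only: mult_ac)
      also have "\<dots> = theta p (y - x + g) * c y i - theta p (t + (y - x)) * theta p g / theta p t * c x i"
        unfolding theta_exchange_coefficients [OF p nz(1,2) y_nz [OF that] x_nz [OF that]] left_diff_distrib c_def
        by (simp only: mult.assoc)
      finally show ?thesis .
    qed
    then have E: "theta p (y - x) * (\<Sum>i<n. E i * V i) = theta p (y - x + g) * (\<Sum>i<n. c y i * V i)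
        - theta p (t + (y - x)) * theta p g / theta p t * (\<Sum>i<n. c x i * V i)"
      unfolding sum_distrib_left sum_subtractf [symmetric]
      by (intro sum.cong refl) (simp only: lessThan_iff mult.assoc [symmetric] left_diff_distrib [symmetric])
    have folds: "(\<Prod>j=1..L. theta p (w - mu j)) = M w"
      "(\<Prod>i<n. theta p (w - zs ! i + g) / theta p (w - zs ! i)) = P w" for w
      by (simp_all only: M_def P_def)
    have E_fold: "theta p g * theta p (t + (y - zs ! i)) / (theta p t * theta p (y - zs ! i))
      * M (zs ! i) * (theta p (zs ! i - x + g) / theta p (zs ! i - x) * R i) = E i" for i
      by (simp only: E_def)
    have R_0: "(\<Prod>j\<in>{..<Suc n} - {0}. theta p (x - (x # zs) ! j + g) / theta p (x - (x # zs) ! j)) = P x"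
      unfolding P_def by (rule prod.reindex_bij_witness [of _ Suc "\<lambda>j. j - 1"]) auto
    have R_Suc: "(\<Prod>j\<in>{..<Suc n} - {Suc i}. theta p (zs ! i - (x # zs) ! j + g) / theta p (zs ! i - (x # zs) ! j))
        = theta p (zs ! i - x + g) / theta p (zs ! i - x) * R i" for i
    proof -
      have "{..<Suc n} - {Suc i} = insert 0 (Suc ` ({..<n} - {i}))"
        by (auto simp: image_iff less_Suc_eq_0_disj)
      then show ?thesis by (simp add: R_def prod.reindex)
    qed
    have "D_chainB p g mu L tau y k (x # zs) s = ?Q / theta p (t + g) * (theta p (y - x + g) / theta p (y - x) * (M y * P y * W)
       - (theta p g * theta p (t + (y - x)) / (theta p t * theta p (y - x)) * (M x * P x * Y) + (\<Sum>i<n. E i * V i)))"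
      by (rule exchange_solve [OF nz(1,3,4) exch E])
    also have "\<dots> = theta p (tau + of_nat (k + length (x # zs) + 1) * g) / theta p (t + g)
     * ((\<Prod>j=1..L. theta p (y - mu j)) * (\<Prod>i<length (x # zs). theta p (y - (x # zs) ! i + g) / theta p (y - (x # zs) ! i))
          * chainB p g mu L tau k (x # zs) s
        - (\<Sum>i<length (x # zs). theta p g * theta p (t + (y - (x # zs) ! i)) / (theta p t * theta p (y - (x # zs) ! i))
            * (\<Prod>j=1..L. theta p ((x # zs) ! i - mu j))
            * (\<Prod>j\<in>{..<length (x # zs)} - {i}. theta p ((x # zs) ! i - (x # zs) ! j + g) / theta p ((x # zs) ! i - (x # zs) ! j))
            * chainB p g mu L tau k ((x # zs)[i := y]) s))"
    proof -
      have len: "length (x # zs) = Suc n" "k + Suc n + 1 = k + n + 2" by (simp_all add: n_def)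
      show ?thesis
        unfolding len prod.lessThan_Suc_shift sum.lessThan_Suc_shift nth_Cons_0 nth_Cons_Suc
          list_update.simps(2) nat.case R_0 R_Suc W_def [symmetric] Y_def [symmetric] V_fold folds E_fold
        by (simp only: mult_ac)
    qed
    finally show ?thesis .
  qed
qed

section \<open>The two evaluations and the elimination\<close>

lemma prod_Icc_minus_Suc:
  fixes f :: "nat \<Rightarrow> complex"
  shows "(\<Prod>j\<in>{1..L} - {Suc i}. f j) = (\<Prod>j\<in>{..<L} - {i}. f (Suc j))"
  by (rule prod.reindex_bij_witness [of _ Suc "\<lambda>j. j - 1"]) auto

text \<open>Both evaluations of D at level 1 against the state of all spins down. The chain starting
  at level 2 is the partition function at \<open>tau + g\<close>, the quantity to be
  eliminated.\<close>

lemma Zpf_expand: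
  assumes p: "0 < p" "p < 1"
    and gen: "\<And>m::int. \<bar>m\<bar> \<le> 2 * int L + 2 \<Longrightarrow> theta p (tau + of_int m * g) \<noteq> 0"
    and y: "\<And>j. j \<in> {1..L} \<Longrightarrow> theta p (y - X j) \<noteq> 0"
    and X: "\<And>i j. i \<in> {1..L} \<Longrightarrow> j \<in> {1..L} \<Longrightarrow> i \<noteq> j \<Longrightarrow> theta p (X i - X j) \<noteq> 0"
  shows "(\<Prod>j=1..L. theta p (y - mu j + g)) * chainB p g mu L tau 2 (map X [1..<L+1]) (replicate L False)
     = (\<Prod>j=1..L. theta p (y - mu j)) * (\<Prod>j=1..L. theta p (y - X j + g) / theta p (y - X j)) * Zpf p g mu L tau X
       - (\<Sum>i=1..L. theta p g * theta p (y - X i + tau + of_nat (L+1) * g) / (theta p (tau + of_nat (L+1) * g) * theta p (y - X i))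
            * (\<Prod>j=1..L. theta p (X i - mu j))
            * (\<Prod>j\<in>{1..L} - {i}. theta p (X i - X j + g) / theta p (X i - X j))
            * Zpf p g mu L tau (X(i := y)))"
proof -
  define xs where "xs = map X [1..<L+1]"
  have len: "length xs = L" by (simp add: xs_def)
  have nth: "xs ! i = X (Suc i)" if "i < L" for i
    using that by (simp add: xs_def del: upt_Suc)
  have upd: "chainB p g mu L tau 1 (xs[i := y]) (replicate L False) = Zpf p g mu L tau (X(Suc i := y))" if "i < L" for i
  proof -
    have "xs[i := y] = map (X(Suc i := y)) [1..<L+1]"
      using that by (intro nth_equalityI) (auto simp: xs_def nth_list_update simp del: upt_Suc)
    then show ?thesis by (simp add: Zpf_def)
  qed
  let ?s = "replicate L False"
  \<comment> \<open>For level 1 and \<open>L\<close> arguments the multiple of \<open>g\<close> is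
    \<open>1 + 2 L - L\<close>.\<close>
  define t where "t = tau + of_nat (L + 1) * g"
  have t: "t = tau + of_int (int 1 + 2 * int (length xs) - int L) * g"
    by (simp add: t_def len algebra_simps)
  have Q: "tau + of_nat (1 + L + 1) * g = t + g"
    by (simp add: t_def algebra_simps)
  have "theta p (t + g) \<noteq> 0"
  proof -
    have "t + g = tau + of_int (int L + 2) * g" by (simp add: t_def algebra_simps)
    then show ?thesis using gen [of "int L + 2"] by simp
  qed
  then have Q1: "theta p (tau + of_nat (1 + L + 1) * g) / theta p (t + g) = 1"
    unfolding Q by simp
  have "D_chainB p g mu L tau y 1 xs ?s = theta p (tau + of_nat (1 + length xs + 1) * g) / theta p (t + g)
     * ((\<Prod>j=1..L. theta p (y - mu j)) * (\<Prod>i<length xs. theta p (y - xs ! i + g) / theta p (y - xs ! i))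
          * chainB p g mu L tau 1 xs ?s
        - (\<Sum>i<length xs. theta p g * theta p (t + (y - xs ! i)) / (theta p t * theta p (y - xs ! i))
            * (\<Prod>j=1..L. theta p (xs ! i - mu j))
            * (\<Prod>j\<in>{..<length xs} - {i}. theta p (xs ! i - xs ! j + g) / theta p (xs ! i - xs ! j))
            * chainB p g mu L tau 1 (xs[i := y]) ?s))"
  proof (rule D_chainB_expand [OF p gen _ _ _ _ _ t])
    show "theta p (y - x) \<noteq> 0" if "x \<in> set xs" for x
      using that y by (auto simp: xs_def simp del: upt_Suc)
    show "theta p (xs ! i - xs ! j) \<noteq> 0" if "i < length xs" "j < length xs" "i \<noteq> j" for i j
      using that X [of "Suc i" "Suc j"] by (simp add: len nth)
  qed (simp_all add: len)
  also have "\<dots> = (\<Prod>j=1..L. theta p (y - mu j)) * (\<Prod>i<L. theta p (y - X (Suc i) + g) / theta p (y - X (Suc i)))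
          * Zpf p g mu L tau X
        - (\<Sum>i<L. theta p g * theta p (t + (y - X (Suc i))) / (theta p t * theta p (y - X (Suc i)))
            * (\<Prod>j=1..L. theta p (X (Suc i) - mu j))
            * (\<Prod>j\<in>{..<L} - {i}. theta p (X (Suc i) - X (Suc j) + g) / theta p (X (Suc i) - X (Suc j)))
            * Zpf p g mu L tau (X(Suc i := y)))"
    unfolding len Q1 mult_1_left
  proof (intro arg_cong2 [of _ _ _ _ "(-)"] arg_cong2 [of _ _ _ _ "(*)"] refl)
    show "(\<Prod>i<L. theta p (y - xs ! i + g) / theta p (y - xs ! i))
        = (\<Prod>i<L. theta p (y - X (Suc i) + g) / theta p (y - X (Suc i)))"
      by (intro prod.cong refl) (simp add: nth)
    show "chainB p g mu L tau 1 xs ?s = Zpf p g mu L tau X"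
      by (simp add: Zpf_def xs_def)
    show "(\<Sum>i<L. theta p g * theta p (t + (y - xs ! i)) / (theta p t * theta p (y - xs ! i))
            * (\<Prod>j=1..L. theta p (xs ! i - mu j))
            * (\<Prod>j\<in>{..<L} - {i}. theta p (xs ! i - xs ! j + g) / theta p (xs ! i - xs ! j))
            * chainB p g mu L tau 1 (xs[i := y]) ?s)
       = (\<Sum>i<L. theta p g * theta p (t + (y - X (Suc i))) / (theta p t * theta p (y - X (Suc i)))
            * (\<Prod>j=1..L. theta p (X (Suc i) - mu j))
            * (\<Prod>j\<in>{..<L} - {i}. theta p (X (Suc i) - X (Suc j) + g) / theta p (X (Suc i) - X (Suc j)))
            * Zpf p g mu L tau (X(Suc i := y)))"
    proof (rule sum.cong [OF refl])
      fix i assume "i \<in> {..<L}"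
      then have i: "i < L" by simp
      have "(\<Prod>j\<in>{..<L} - {i}. theta p (xs ! i - xs ! j + g) / theta p (xs ! i - xs ! j))
          = (\<Prod>j\<in>{..<L} - {i}. theta p (X (Suc i) - X (Suc j) + g) / theta p (X (Suc i) - X (Suc j)))"
        by (intro prod.cong refl) (simp add: nth i)
      then show "theta p g * theta p (t + (y - xs ! i)) / (theta p t * theta p (y - xs ! i))
            * (\<Prod>j=1..L. theta p (xs ! i - mu j))
            * (\<Prod>j\<in>{..<L} - {i}. theta p (xs ! i - xs ! j + g) / theta p (xs ! i - xs ! j))
            * chainB p g mu L tau 1 (xs[i := y]) ?s
          = theta p g * theta p (t + (y - X (Suc i))) / (theta p t * theta p (y - X (Suc i)))
            * (\<Prod>j=1..L. theta p (X (Suc i) - mu j))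
            * (\<Prod>j\<in>{..<L} - {i}. theta p (X (Suc i) - X (Suc j) + g) / theta p (X (Suc i) - X (Suc j)))
            * Zpf p g mu L tau (X(Suc i := y))"
        by (simp only: nth [OF i] upd [OF i])
    qed
  qed
  also have "\<dots> = (\<Prod>j=1..L. theta p (y - mu j)) * (\<Prod>j=1..L. theta p (y - X j + g) / theta p (y - X j)) * Zpf p g mu L tau X
       - (\<Sum>i=1..L. theta p g * theta p (y - X i + tau + of_nat (L+1) * g) / (theta p (tau + of_nat (L+1) * g) * theta p (y - X i))
            * (\<Prod>j=1..L. theta p (X i - mu j))
            * (\<Prod>j\<in>{1..L} - {i}. theta p (X i - X j + g) / theta p (X i - X j))
            * Zpf p g mu L tau (X(i := y)))"
  proof -
    have arg: "t + (y - X i) = y - X i + tau + of_nat (L+1) * g" for i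
      by (simp add: t_def algebra_simps)
    have shift: "(\<Prod>j=1..L. f j) = (\<Prod>j<L. f (Suc j))" "(\<Sum>j=1..L. f j) = (\<Sum>j<L. f (Suc j))"
      for f :: "nat \<Rightarrow> complex"
      by (simp_all add: prod.atLeast1_atMost_eq sum.atLeast1_atMost_eq)
    show ?thesis
      unfolding shift prod_Icc_minus_Suc arg t_def [symmetric] ..
  qed
  \<comment> \<open>This rewrites the left end of the calculation: against the state of all spins
    down, D keeps only the summand where \<open>q\<close> is that state.\<close>
  also have "D_chainB p g mu L tau y 1 xs ?s = (\<Prod>j=1..L. theta p (y - mu j + g)) * chainB p g mu L tau 2 xs ?s"
  proof -
    have "D_chainB p g mu L tau y 1 xs ?s = (\<Sum>q\<in>{q. length q = L}. if q = ?s
        then (\<Prod>j\<in>{1..<1+L}. theta p (y - mu j + g)) * chainB p g mu L tau 2 xs ?s else 0)"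
      unfolding D_chainB_def
    proof (rule sum.cong [OF refl])
      fix q :: "bool list" assume "q \<in> {q. length q = L}"
      then have "length q = L" by simp
      from monoT_D_dual_vacuum [OF this, of p g mu 1 y "tau + of_nat 1 * g"]
      show "monoT p g mu 1 y (tau + of_nat 1 * g) False False ?s q * chainB p g mu L tau (Suc 1) xs q
        = (if q = ?s then (\<Prod>j\<in>{1..<1+L}. theta p (y - mu j + g)) * chainB p g mu L tau 2 xs ?s else 0)"
        by (simp only: numeral_2_eq_2 One_nat_def if_distrib [of "\<lambda>z. z * _"] mult_zero_left split: if_split) simp
    qed
    also have "\<dots> = (\<Prod>j\<in>{1..<1+L}. theta p (y - mu j + g)) * chainB p g mu L tau 2 xs ?s"
      by (subst sum.delta) (simp_all add: finite_bool_lists)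
    also have "{1..<1+L} = {1..L}" by auto
    finally show ?thesis .
  qed
  finally show ?thesis unfolding xs_def .
qed

theorem theorem4p1:
  fixes p :: real and g :: complex and L :: nat and mu :: "nat \<Rightarrow> complex"
    and tau x0 xb :: complex and X :: "nat \<Rightarrow> complex"
  assumes "0 < p" "p < 1" "1 \<le> L"
    and gen_tau: "\<forall>n::int. \<bar>n\<bar> \<le> 2 * int L + 2 \<longrightarrow> theta p (tau + of_int n * g) \<noteq> 0"
    and gen_x: "\<forall>j\<in>{1..L}. theta p (x0 - X j) \<noteq> 0 \<and> theta p (xb - X j) \<noteq> 0
                         \<and> theta p (x0 - mu j + g) \<noteq> 0"
    and gen_xx: "\<forall>i\<in>{1..L}. \<forall>j\<in>{1..L}. i \<noteq> j \<longrightarrow> theta p (X i - X j) \<noteq> 0"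
  shows
   "let th = theta p;
        M0 = (\<Prod>j=1..L. th (x0 - X j + g) * th (x0 - mu j) * th (xb - mu j + g)
                         / (th (x0 - X j) * th (x0 - mu j + g)))
             - (\<Prod>j=1..L. th (xb - X j + g) * th (xb - mu j) / th (xb - X j));
        N = (\<lambda>i. - (th g * th (x0 - X i + tau + of_nat (L+1) * g))
                   / (th (tau + of_nat (L+1) * g) * th (x0 - X i))
                 * (\<Prod>j=1..L. th (X i - mu j) * th (xb - mu j + g) / th (x0 - mu j + g))
                 * (\<Prod>j\<in>{1..L} - {i}. th (X i - X j + g) / th (X i - X j)));
        Nb = (\<lambda>i. (th g * th (xb - X i + tau + of_nat (L+1) * g))
                   / (th (tau + of_nat (L+1) * g) * th (xb - X i))
                 * (\<Prod>j=1..L. th (X i - mu j))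
                 * (\<Prod>j\<in>{1..L} - {i}. th (X i - X j + g) / th (X i - X j)))
    in M0 * Zpf p g mu L tau X
       + (\<Sum>i=1..L. N i * Zpf p g mu L tau (X(i := x0)))
       + (\<Sum>i=1..L. Nb i * Zpf p g mu L tau (X(i := xb))) = 0"
proof -
  have gen: "theta p (tau + of_int m * g) \<noteq> 0" if "\<bar>m\<bar> \<le> 2 * int L + 2" for m :: int
    using gen_tau that by blast
  define a where "a = (\<lambda>y. \<Prod>j=1..L. theta p (y - mu j + g))"
  define m where "m = (\<lambda>y. \<Prod>j=1..L. theta p (y - mu j))"
  define r where "r = (\<lambda>y. \<Prod>j=1..L. theta p (y - X j + g) / theta p (y - X j))"
  define R where "R = (\<lambda>i. \<Prod>j\<in>{1..L} - {i}. theta p (X i - X j + g) / theta p (X i - X j))"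
  define c where "c = (\<lambda>y i. theta p g * theta p (y - X i + tau + of_nat (L+1) * g)
      / (theta p (tau + of_nat (L+1) * g) * theta p (y - X i)) * m (X i) * R i)"
  define Z where "Z = Zpf p g mu L tau X"
  define Z' where "Z' = chainB p g mu L tau 2 (map X [1..<L+1]) (replicate L False)"
  define S where "S = (\<lambda>y. \<Sum>i=1..L. c y i * Zpf p g mu L tau (X(i := y)))"
  have expand: "a y * Z' = m y * r y * Z - S y" if "y \<in> {x0, xb}" for y
    unfolding a_def m_def r_def R_def c_def Z_def Z'_def S_def
    using assms(1,2) gen gen_x gen_xx that by (intro Zpf_expand) auto
  \<comment> \<open>The elimination divides by this eigenvalue of D(x0), which is the source of the
    denominators \<open>[x0 - \<mu> + g]\<close> in the coefficients.\<close>
  have a0: "a x0 \<noteq> 0"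
    using gen_x by (simp add: a_def)
  have "(\<Prod>j=1..L. theta p (x0 - X j + g) * theta p (x0 - mu j) * theta p (xb - mu j + g)
         / (theta p (x0 - X j) * theta p (x0 - mu j + g))) = r x0 * m x0 * a xb / a x0"
    by (simp add: r_def m_def a_def prod.distrib prod_dividef)
  moreover have "(\<Prod>j=1..L. theta p (xb - X j + g) * theta p (xb - mu j) / theta p (xb - X j)) = r xb * m xb"
    by (simp add: r_def m_def prod.distrib prod_dividef)
  moreover have "(\<Prod>j=1..L. theta p (X i - mu j) * theta p (xb - mu j + g) / theta p (x0 - mu j + g))
      = m (X i) * a xb / a x0" for i
    by (simp add: m_def a_def prod.distrib prod_dividef)
  moreover have "(\<Sum>i=1..L. - (theta p g * theta p (x0 - X i + tau + of_nat (L+1) * g))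
        / (theta p (tau + of_nat (L+1) * g) * theta p (x0 - X i)) * (m (X i) * a xb / a x0) * R i
        * Zpf p g mu L tau (X(i := x0))) = - (a xb / a x0) * S x0"
    unfolding S_def sum_distrib_left by (intro sum.cong refl) (simp add: c_def mult_ac)
  moreover have "(r x0 * m x0 * a xb / a x0 - r xb * m xb) * Z + - (a xb / a x0) * S x0 + S xb = 0"
  proof -
    \<comment> \<open>The combination is \<open>a xb / a x0\<close> times the expansion at
      \<open>x0\<close> minus the expansion at \<open>xb\<close>.\<close>
    have "(r x0 * m x0 * a xb / a x0 - r xb * m xb) * Z + - (a xb / a x0) * S x0 + S xb
      = a xb / a x0 * (m x0 * r x0 * Z - S x0) - (m xb * r xb * Z - S xb)"
      by (simp add: algebra_simps)
    also have "\<dots> = a xb / a x0 * (a x0 * Z') - a xb * Z'"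
      by (simp only: expand insert_iff simp_thms)
    also have "\<dots> = 0" using a0 by simp
    finally show ?thesis .
  qed
  ultimately show ?thesis
    unfolding Let_def S_def c_def Z_def R_def m_def by (simp only:)
qed

end
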